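(* Let $\mathcal{S}$ be a compact Polish space, $U$ a compact metric space, and let the controlled transition kernel be $p(\mathrm{d}y\,|\,x,u)=\varphi(y\,|\,x,u)\,\gamma(\mathrm{d}y)\in\mathcal{P}(\mathcal{S})$ for $(x,u)\in\mathcal{S}\times U$, where $\gamma$ is a positive measure on $\mathcal{S}$ with full support and $\varphi(\cdot\,|\,\cdot,\cdot)>0$ is continuous. Let $k\colon\mathcal{S}\times U\to\mathbb{R}$ be continuous. Let $\Lambda\in(0,\infty)$ and $V\in C(\mathcal{S};[0,\infty))$, $V\not\equiv0$, solve $$\Lambda V(x)=\min_{u\in U}\Bigl(e^{k(x,u)}\int_{\mathcal{S}}p(\mathrm{d}y\,|\,x,u)\,V(y)\Bigr),\qquad x\in\mathcal{S}.\qquad(\ast)$$ Fix $x_0\in\mathcal{S}$ and an initial function $J_0=V_0>0$ on $\mathcal{S}$, and define, for $n\ge0$ and $x\in\mathcal{S}$, the value iteration $$J_{n+1}(x)=\frac{1}{\Lambda}\min_{u\in U}\int_{\mathcal{S}}p(\mathrm{d}y\,|\,x,u)\,e^{k(x,u)}J_n(y)$$ and the relative value iteration $$V_{n+1}(x)=\frac{1}{V_n(x_0)}\min_{u\in U}\int_{\mathcal{S}}p(\mathrm{d}y\,|\,x,u)\,e^{k(x,u)}V_n(y).$$ Let $\{X^*_n\}$ be the stationary chain with transition kernel $p^*$ (defined in the context), and let $Y_n=X^*_{-n}$, $n\in\mathbb{N}$. Then $J_n(Y_n)/V(Y_n)$ is a reverse submartingale, which converges almost surely and in $L_1$ to a random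 variable $\zeta$, and $J_n(x)\to\zeta V(x)$ as $n\to\infty$ for $\gamma$-a.s. $x\in\mathcal{S}$. Moreover, $V_n(x)\to\bar V(x)$ as $n\to\infty$ for $\gamma$-a.s. $x\in\mathcal{S}$, where $\bar V$ satisfies $(\ast)$ (with the same $\Lambda$) and $\bar V(x_0)=\Lambda$, which uniquely specifies $\bar V$.
   Context: $\mathcal{P}(\mathcal{S})$ denotes the set of Borel probability measures on $\mathcal{S}$. It is a known fact, taken as background, that under the stated assumptions the equation $(\ast)$ has a solution $V\in C(\mathcal{S};[0,\infty))$, $\Lambda\in(0,\infty)$, that $\Lambda$ is unique, and that $V$ is unique up to multiplication by a positive scalar. Let $v^*\colon\mathcal{S}\to U$ be a measurable minimizer of the right-hand side of $(\ast)$ (it exists by a measurable selection theorem). The transition kernel $p^*$ is $$p^*(\mathrm{d}y\,|\,x)=\bigl(\Lambda V(x)\bigr)^{-1}p\bigl(\mathrm{d}y\,|\,x,v^*(x)\bigr)\,e^{k(x,v^*(x))}\,V(y).$$ Equation $(\ast)$ is the dynamic programming equation for minimizing $\limsup_{n\to\infty}\frac1n\log\mathbb{E}\bigl[e^{\sum_{m=0}^{n-1}k(X_m,Z_m)}\bigr]$ over controlled chains $X_n$ with $U$-valued control process $Z_n$. *)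

theory Defs
  imports "HOL-Probability.Probability"
begin

section \<open>The controlled kernel and the dynamic programming equation\<close>

definition ctrl_kernel ::
  "'s measure \<Rightarrow> ('s \<Rightarrow> 's \<Rightarrow> 'u \<Rightarrow> real) \<Rightarrow> 's \<Rightarrow> 'u \<Rightarrow> 's measure" where
  "ctrl_kernel \<gamma> \<phi> x u = density \<gamma> (\<lambda>y. ennreal (\<phi> y x u))"

definition full_support :: "'s::topological_space measure \<Rightarrow> bool" where
  "full_support \<gamma> \<longleftrightarrow> (\<forall>G. open G \<longrightarrow> G \<noteq> {} \<longrightarrow> 0 < emeasure \<gamma> G)"

text \<open>A genuine minimum, not an infimum: \<open>LEAST\<close> denotes nothing specific unless the minimum is
  attained. The lemma below covers every use made of it here, all integrands being continuous
  in the control.\<close>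

definition min_over :: "('u \<Rightarrow> real) \<Rightarrow> real" where
  "min_over f = (LEAST m. m \<in> range f)"

lemma min_over_attained:
  fixes f :: "'u::topological_space \<Rightarrow> real"
  assumes "compact (UNIV :: 'u set)" and "continuous_on UNIV f"
  shows "min_over f \<in> range f" and "min_over f \<le> f u"
proof -
  obtain w where w: "\<And>z. f w \<le> f z"
    using continuous_attains_inf[OF assms(1) _ assms(2)] by auto
  have "min_over f = f w"
    unfolding min_over_def using w by (intro Least_equality) auto
  then show "min_over f \<in> range f" and "min_over f \<le> f u"
    using w by auto
qed

definition dp_solution ::
  "('s::topological_space \<Rightarrow> 'u \<Rightarrow> 's measure) \<Rightarrow> ('s \<Rightarrow> 'u \<Rightarrow> real) \<Rightarrow> real \<Rightarrow> ('s \<Rightarrow> real) \<Rightarrow> bool"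
where
  "dp_solution p k \<Lambda> V \<longleftrightarrow>
     continuous_on UNIV V \<and> (\<forall>x. 0 \<le> V x) \<and>
     (\<forall>x. \<Lambda> * V x = min_over (\<lambda>u. exp (k x u) * (\<integral>y. V y \<partial>(p x u))))"

definition measurable_minimizer ::
  "('s::topological_space \<Rightarrow> 'u::topological_space \<Rightarrow> 's measure) \<Rightarrow> ('s \<Rightarrow> 'u \<Rightarrow> real) \<Rightarrow>
   ('s \<Rightarrow> real) \<Rightarrow> ('s \<Rightarrow> 'u) \<Rightarrow> bool" where
  "measurable_minimizer p k V v \<longleftrightarrow>
     v \<in> borel_measurable borel \<and>
     (\<forall>x u. exp (k x (v x)) * (\<integral>y. V y \<partial>(p x (v x))) \<le> exp (k x u) * (\<integral>y. V y \<partial>(p x u)))"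

definition opt_kernel ::
  "('s \<Rightarrow> 'u \<Rightarrow> 's measure) \<Rightarrow> ('s \<Rightarrow> 'u \<Rightarrow> real) \<Rightarrow> real \<Rightarrow> ('s \<Rightarrow> real) \<Rightarrow> ('s \<Rightarrow> 'u) \<Rightarrow> 's \<Rightarrow> 's measure"
where
  "opt_kernel p k \<Lambda> V v x =
     density (p x (v x)) (\<lambda>y. ennreal (inverse (\<Lambda> * V x) * exp (k x (v x)) * V y))"

section \<open>Value iteration and relative value iteration\<close>

primrec value_iter ::
  "('s \<Rightarrow> 'u \<Rightarrow> 's measure) \<Rightarrow> ('s \<Rightarrow> 'u \<Rightarrow> real) \<Rightarrow> real \<Rightarrow> ('s \<Rightarrow> real) \<Rightarrow> nat \<Rightarrow> 's \<Rightarrow> real"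
where
  "value_iter p k \<Lambda> J0 0 = J0"
| "value_iter p k \<Lambda> J0 (Suc n) =
     (\<lambda>x. 1 / \<Lambda> * min_over (\<lambda>u. \<integral>y. exp (k x u) * value_iter p k \<Lambda> J0 n y \<partial>(p x u)))"

primrec rel_value_iter ::
  "('s \<Rightarrow> 'u \<Rightarrow> 's measure) \<Rightarrow> ('s \<Rightarrow> 'u \<Rightarrow> real) \<Rightarrow> 's \<Rightarrow> ('s \<Rightarrow> real) \<Rightarrow> nat \<Rightarrow> 's \<Rightarrow> real"
where
  "rel_value_iter p k x0 V0 0 = V0"
| "rel_value_iter p k x0 V0 (Suc n) =
     (\<lambda>x. 1 / rel_value_iter p k x0 V0 n x0 *
          min_over (\<lambda>u. \<integral>y. exp (k x u) * rel_value_iter p k x0 V0 n y \<partial>(p x u)))"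

section \<open>Stationary Markov chains and reverse submartingales\<close>

definition generated_sigma ::
  "'w measure \<Rightarrow> ('i \<Rightarrow> 'w \<Rightarrow> 's::topological_space) \<Rightarrow> 'i set \<Rightarrow> 'w measure" where
  "generated_sigma M X I =
     sigma (space M) {X i -` A \<inter> space M | i A. i \<in> I \<and> A \<in> sets borel}"

definition stationary_markov_chain ::
  "'w measure \<Rightarrow> (int \<Rightarrow> 'w \<Rightarrow> 's::topological_space) \<Rightarrow> ('s \<Rightarrow> 's measure) \<Rightarrow> bool" where
  "stationary_markov_chain M X P \<longleftrightarrow>
     prob_space M \<and>
     (\<forall>n. X n \<in> borel_measurable M) \<and>
     (\<forall>n. \<forall>A\<in>sets borel.
        AE \<omega> in M. real_cond_exp M (generated_sigma M X {..n}) (\<lambda>\<omega>'. indicator A (X (n + 1) \<omega>')) \<omega>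
                   = measure (P (X n \<omega>)) A) \<and>
     distr M (\<Pi>\<^sub>M i\<in>UNIV. borel) (\<lambda>\<omega> i. X (i + 1) \<omega>) = distr M (\<Pi>\<^sub>M i\<in>UNIV. borel) (\<lambda>\<omega> i. X i \<omega>)"

definition reverse_submartingale ::
  "'w measure \<Rightarrow> (nat \<Rightarrow> 'w measure) \<Rightarrow> (nat \<Rightarrow> 'w \<Rightarrow> real) \<Rightarrow> bool" where
  "reverse_submartingale M F Z \<longleftrightarrow>
     (\<forall>n. subalgebra M (F n)) \<and>
     (\<forall>n. subalgebra (F n) (F (Suc n))) \<and>
     (\<forall>n. Z n \<in> borel_measurable (F n)) \<and>
     (\<forall>n. integrable M (Z n)) \<and>
     (\<forall>n. AE \<omega> in M. Z (Suc n) \<omega> \<le> real_cond_exp M (F (Suc n)) (Z n) \<omega>)"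

end

theory Submission
  imports Defs
begin

text \<open>
  Put \<open>h\<^sub>n = J\<^sub>n / V\<close> and
  \<open>q(x,u,y) = e\<^bsup>k(x,u)\<^esup> \<phi>(y|x,u) V(y) / (\<Lambda> V(x))\<close>. The dynamic programming equation says that
  \<open>\<integral> q(x,u,y) \<gamma>(dy) \<ge> 1\<close>, with equality for some \<open>u\<close>, while \<open>h\<^sub>n\<^sub>+\<^sub>1(x)\<close> is the minimum
  over \<open>u\<close> of \<open>\<integral> q(x,u,y) h\<^sub>n(y) \<gamma>(dy)\<close>. Compactness gives \<open>q \<ge> \<delta> > 0\<close>, a Doeblin minorization,
  so the oscillation of \<open>h\<^sub>n\<close> shrinks by the factor \<open>1 - \<delta> \<gamma>(S)\<close> in every step. Hence
  \<open>h\<^sub>n\<close> converges uniformly to a positive constant \<open>c\<close>, and \<open>\<zeta>\<close> is that constant. The relative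
  iterates are \<open>V\<^sub>n\<^sub>+\<^sub>1 = \<Lambda> J\<^sub>n\<^sub>+\<^sub>1 / J\<^sub>n(x\<^sub>0)\<close>, and starting the iteration at another solution
  of the equation, which is a fixed point, shows that it is a multiple of \<open>V\<close>.
\<close>

section \<open>Contraction of the oscillation\<close>

lemma min_over_eqI:
  assumes "f w = c" and "\<And>u. c \<le> f u"
  shows "min_over f = c"
  unfolding min_over_def using assms by (intro Least_equality) auto

lemma continuous_bounds_pos:
  fixes f :: "'a::topological_space \<Rightarrow> real"
  assumes "compact (UNIV :: 'a set)" and "continuous_on UNIV f" and "\<And>x. 0 < f x"
  obtains c C where "0 < c" and "c \<le> C" and "\<And>x. c \<le> f x" and "\<And>x. f x \<le> C"
proof -
  obtain a where "\<And>x. f a \<le> f x"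
    using continuous_attains_inf[OF assms(1) _ assms(2)] by auto
  moreover obtain b where "\<And>x. f x \<le> f b"
    using continuous_attains_sup[OF assms(1) _ assms(2)] by auto
  ultimately show thesis
    using assms(3)[of a] by (intro that[of "f a" "f b"]) auto
qed

text \<open>The facts \<open>h_le\<close> and \<open>h_attained\<close> together say that
  \<open>h (Suc n) x\<close> is a minimum over the controls. Likewise \<open>q_mass\<close> and
  \<open>q_stoch\<close> encode that the least total mass of \<open>q x u\<close> is 1, which is the
  dynamic programming equation after division by \<open>\<Lambda> * V x\<close>. The bound
  \<open>q_ge\<close> is the minorization.\<close>

locale weighted_min_iteration = finite_measure \<gamma>
  for \<gamma> :: "'s measure" +
  fixes q :: "'s \<Rightarrow> 'u \<Rightarrow> 's \<Rightarrow> real" and \<delta> :: real and h :: "nat \<Rightarrow> 's \<Rightarrow> real"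
  assumes \<delta>_pos: "0 < \<delta>"
    and q_ge: "\<And>x u y. \<delta> \<le> q x u y"
    and q_int: "\<And>x u. integrable \<gamma> (q x u)"
    and q_mass: "\<And>x u. 1 \<le> (\<integral>y. q x u y \<partial>\<gamma>)"
    and q_stoch: "\<And>x. \<exists>u. (\<integral>y. q x u y \<partial>\<gamma>) = 1"
    and h_int: "\<And>n. integrable \<gamma> (h n)"
    and qh_int: "\<And>n x u. integrable \<gamma> (\<lambda>y. q x u y * h n y)"
    and h_le: "\<And>n x u. h (Suc n) x \<le> (\<integral>y. q x u y * h n y \<partial>\<gamma>)"
    and h_attained: "\<And>n x. \<exists>u. h (Suc n) x = (\<integral>y. q x u y * h n y \<partial>\<gamma>)"
    and space_nonnull: "0 < measure \<gamma> (space \<gamma>)"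
begin

text \<open>At the minimizing control, split \<open>h n\<close> as \<open>a + (h n - a)\<close>. The
  constant part has weight at least 1 and so contributes at least \<open>a\<close>, which is where
  \<open>0 \<le> a\<close> enters; the nonnegative excess is weighted by at least
  \<open>\<delta>\<close>.\<close>

lemma step_ge:
  assumes "0 \<le> a" and "\<And>y. a \<le> h n y"
  shows "a + \<delta> * ((\<integral>y. h n y \<partial>\<gamma>) - a * measure \<gamma> (space \<gamma>)) \<le> h (Suc n) x"
proof -
  obtain u where u: "h (Suc n) x = (\<integral>y. q x u y * h n y \<partial>\<gamma>)"
    using h_attained by blast
  have "\<delta> * ((\<integral>y. h n y \<partial>\<gamma>) - a * measure \<gamma> (space \<gamma>)) = (\<integral>y. \<delta> * (h n y - a) \<partial>\<gamma>)"
    using h_int by (simp add: Bochner_Integration.integral_diff mult.commute)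
  also have "\<dots> \<le> (\<integral>y. q x u y * (h n y - a) \<partial>\<gamma>)"
  proof (rule integral_mono)
    show "\<delta> * (h n y - a) \<le> q x u y * (h n y - a)" for y
      using assms(2)[of y] q_ge by (intro mult_right_mono) auto
  qed (use q_int qh_int h_int in \<open>auto simp: right_diff_distrib\<close>)
  also have "\<dots> = (\<integral>y. q x u y * h n y \<partial>\<gamma>) - a * (\<integral>y. q x u y \<partial>\<gamma>)"
    using q_int qh_int by (simp add: right_diff_distrib mult.commute)
  finally show ?thesis
    using u mult_left_mono[OF q_mass assms(1), of x u] by simp
qed

text \<open>The control is chosen differently here: the one of total mass exactly 1, so that the
  constant \<open>b\<close> is reproduced exactly. It need not minimize the integral of
  \<open>h n\<close>, but \<open>h_le\<close> bounds the minimum by its value at any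
  control.\<close>

lemma step_le:
  assumes "\<And>y. h n y \<le> b"
  shows "h (Suc n) x \<le> b - \<delta> * (b * measure \<gamma> (space \<gamma>) - (\<integral>y. h n y \<partial>\<gamma>))"
proof -
  obtain u where u: "(\<integral>y. q x u y \<partial>\<gamma>) = 1"
    using q_stoch by blast
  have "\<delta> * (b * measure \<gamma> (space \<gamma>) - (\<integral>y. h n y \<partial>\<gamma>)) = (\<integral>y. \<delta> * (b - h n y) \<partial>\<gamma>)"
    using h_int by (simp add: Bochner_Integration.integral_diff mult.commute)
  also have "\<dots> \<le> (\<integral>y. q x u y * (b - h n y) \<partial>\<gamma>)"
  proof (rule integral_mono)
    show "\<delta> * (b - h n y) \<le> q x u y * (b - h n y)" for y
      using assms[of y] q_ge by (intro mult_right_mono) auto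
  qed (use q_int qh_int h_int in \<open>auto simp: right_diff_distrib\<close>)
  also have "\<dots> = b * (\<integral>y. q x u y \<partial>\<gamma>) - (\<integral>y. q x u y * h n y \<partial>\<gamma>)"
    using q_int qh_int by (simp add: right_diff_distrib mult.commute)
  finally show ?thesis
    using u h_le[of n x u] by simp
qed

text \<open>Keeps the contraction factor
  \<open>1 - \<delta> * measure \<gamma> (space \<gamma>)\<close> nonnegative. The density of mass 1
  dominates the constant \<open>\<delta>\<close>.\<close>

lemma minorization_mass_le_1: "\<delta> * measure \<gamma> (space \<gamma>) \<le> 1"
proof -
  obtain u where u: "(\<integral>y. q undefined u y \<partial>\<gamma>) = 1"
    using q_stoch by blast
  have "\<delta> * measure \<gamma> (space \<gamma>) = (\<integral>y. \<delta> \<partial>\<gamma>)" by simp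
  also have "\<dots> \<le> (\<integral>y. q undefined u y \<partial>\<gamma>)"
    using q_ge q_int by (intro integral_mono) auto
  finally show ?thesis using u by simp
qed

text \<open>Explicit lower and upper bounds are propagated instead of the infimum and supremum of
  \<open>h n\<close>. Their gap shrinks geometrically, so both tend to one constant, which lies
  above \<open>a0\<close> and is therefore positive.\<close>

lemma uniform_limit_const:
  assumes "0 < a0" and lo: "\<And>y. a0 \<le> h 0 y" and hi: "\<And>y. h 0 y \<le> b0"
  obtains c e where "0 < c" and "e \<longlonglongrightarrow> 0" and "\<And>n x. \<bar>h n x - c\<bar> \<le> e n"
proof -
  define m where "m = measure \<gamma> (space \<gamma>)"
  define I where "I n = (\<integral>y. h n y \<partial>\<gamma>)" for n
  \<comment> \<open>These recursions iterate the bounds of \<open>step_ge\<close> and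
    \<open>step_le\<close>.\<close>
  define a where "a = rec_nat a0 (\<lambda>n s. s + \<delta> * (I n - s * m))"
  define b where "b = rec_nat b0 (\<lambda>n s. s - \<delta> * (s * m - I n))"
  have a_Suc: "a (Suc n) = a n + \<delta> * (I n - a n * m)" for n by (simp add: a_def)
  have b_Suc: "b (Suc n) = b n - \<delta> * (b n * m - I n)" for n by (simp add: b_def)
  \<comment> \<open>The mean of \<open>h n\<close> lies between the means of its bounds. Hence
    \<open>a\<close> increases and \<open>b\<close> decreases; in particular \<open>a\<close> stays
    positive, as \<open>step_ge\<close> requires.\<close>
  have mono: "a n * m \<le> I n" "I n \<le> b n * m" if "\<And>x. a n \<le> h n x" "\<And>x. h n x \<le> b n" for n
  proof -
    have "(\<integral>y. a n \<partial>\<gamma>) \<le> I n" "I n \<le> (\<integral>y. b n \<partial>\<gamma>)"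
      unfolding I_def by (rule integral_mono; use that h_int in simp)+
    then show "a n * m \<le> I n" "I n \<le> b n * m" by (simp_all add: m_def mult.commute)
  qed
  have bounds: "0 < a n \<and> (\<forall>x. a n \<le> h n x) \<and> (\<forall>x. h n x \<le> b n)" for n
  proof (induction n)
    case 0
    then show ?case using assms by (simp add: a_def b_def)
  next
    case (Suc n)
    then have "0 < a n" and l: "\<And>x. a n \<le> h n x" and u: "\<And>x. h n x \<le> b n" by auto
    then have "0 \<le> \<delta> * (I n - a n * m)" using mono[of n] \<delta>_pos by simp
    then have "0 < a (Suc n)" using \<open>0 < a n\<close> by (simp add: a_Suc)
    moreover have "a (Suc n) \<le> h (Suc n) x" "h (Suc n) x \<le> b (Suc n)" for x
      using step_ge[of "a n" n x] step_le[of n "b n" x] l u \<open>0 < a n\<close>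
      by (simp_all add: a_Suc b_Suc I_def m_def)
    ultimately show ?case by blast
  qed
  \<comment> \<open>The same term \<open>\<delta> * I n\<close> is added to both bounds, so it
    cancels in the difference and leaves an exact linear recursion.\<close>
  have width: "b n - a n = (1 - \<delta> * m) ^ n * (b0 - a0)" for n
  proof (induction n)
    case (Suc n)
    have "b (Suc n) - a (Suc n) = (1 - \<delta> * m) * (b n - a n)"
      by (simp add: a_Suc b_Suc algebra_simps)
    then show ?case using Suc by simp
  qed (simp add: a_def b_def)
  have "\<bar>1 - \<delta> * m\<bar> < 1"
    using minorization_mass_le_1 \<delta>_pos space_nonnull by (simp add: m_def)
  then have width_0: "(\<lambda>n. b n - a n) \<longlonglongrightarrow> 0"
    unfolding width by (intro tendsto_mult_left_zero LIMSEQ_power_zero) auto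
  have "\<exists>l. ((\<forall>n. a n \<le> l) \<and> a \<longlonglongrightarrow> l) \<and> ((\<forall>n. l \<le> b n) \<and> b \<longlonglongrightarrow> l)"
  proof (rule nested_sequence_unique)
    show "\<forall>n. a n \<le> a (Suc n)" "\<forall>n. b (Suc n) \<le> b n"
      using mono bounds \<delta>_pos by (simp_all add: a_Suc b_Suc)
    show "\<forall>n. a n \<le> b n" using bounds order_trans by blast
    show "(\<lambda>n. a n - b n) \<longlonglongrightarrow> 0" using tendsto_minus[OF width_0] by simp
  qed
  then obtain c where c: "\<And>n. a n \<le> c" "\<And>n. c \<le> b n" by blast
  have "0 < c" using bounds[of 0] c(1)[of 0] by simp
  moreover have "\<bar>h n x - c\<bar> \<le> b n - a n" for n x
  proof -
    have "a n \<le> h n x" "h n x \<le> b n" using bounds[of n] by auto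
    then show ?thesis using c(1)[of n] c(2)[of n] by simp
  qed
  ultimately show thesis using that[of c "\<lambda>n. b n - a n"] width_0 by simp
qed

end

section \<open>The dynamic programming operator\<close>

text \<open>A particular solution \<open>V\<close> is kept out of this locale, so that its results
  also apply to any other solution \<open>W\<close> when uniqueness is shown.\<close>

locale multiplicative_dp =
  fixes \<gamma> :: "'s::polish_space measure"
    and \<phi> :: "'s \<Rightarrow> 's \<Rightarrow> 'u::metric_space \<Rightarrow> real"
    and k :: "'s \<Rightarrow> 'u \<Rightarrow> real"
    and \<Lambda> :: real
  assumes S_compact: "compact (UNIV :: 's set)"
    and U_compact: "compact (UNIV :: 'u set)"
    and \<gamma>_sets [measurable_cong]: "sets \<gamma> = sets borel"
    and \<gamma>_support: "full_support \<gamma>"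
    and \<phi>_pos: "\<And>y x u. 0 < \<phi> y x u"
    and \<phi>_cont: "continuous_on UNIV (\<lambda>(y, x, u). \<phi> y x u)"
    and p_prob: "\<And>x u. prob_space (ctrl_kernel \<gamma> \<phi> x u)"
    and k_cont: "continuous_on UNIV (\<lambda>(x, u). k x u)"
    and \<Lambda>_pos: "0 < \<Lambda>"
begin

text \<open>Integration is moved from the controlled kernel to the fixed measure
  \<open>\<gamma>\<close>. All dependence on the state and the control then sits in one positive
  continuous weight.\<close>

abbreviation Q :: "('s \<Rightarrow> real) \<Rightarrow> 's \<Rightarrow> 'u \<Rightarrow> real" where
  "Q f x u \<equiv> \<integral>y. exp (k x u) * \<phi> y x u * f y \<partial>\<gamma>"

definition bellman :: "('s \<Rightarrow> real) \<Rightarrow> 's \<Rightarrow> real" where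
  "bellman f x = min_over (Q f x)"

lemma space_\<gamma>: "space \<gamma> = UNIV"
  using sets_eq_imp_space_eq[OF \<gamma>_sets] by simp

lemma weight_cont: "continuous_on UNIV (\<lambda>(y, x, u). exp (k x u) * \<phi> y x u)"
proof -
  have "continuous_on UNIV (\<lambda>z. (\<lambda>(x, u). k x u) (fst (snd z), snd (snd z)) :: real)"
    by (rule continuous_on_compose2[OF k_cont]) (auto intro!: continuous_intros)
  then show ?thesis
    using \<phi>_cont by (auto simp: case_prod_unfold intro!: continuous_intros)
qed

lemma weight_measurable [measurable]: "(\<lambda>y. exp (k x u) * \<phi> y x u) \<in> borel_measurable borel"
proof -
  have "continuous_on UNIV (\<lambda>y. (\<lambda>(y, x, u). exp (k x u) * \<phi> y x u) (y, x, u))"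
    by (rule continuous_on_compose2[OF weight_cont]) (auto intro!: continuous_intros)
  then show ?thesis by (intro borel_measurable_continuous_onI) simp
qed

lemma \<phi>_measurable [measurable]: "(\<lambda>y. \<phi> y x u) \<in> borel_measurable borel"
proof -
  have "continuous_on UNIV (\<lambda>y. (\<lambda>(y, x, u). \<phi> y x u) (y, x, u))"
    by (rule continuous_on_compose2[OF \<phi>_cont]) (auto intro!: continuous_intros)
  then show ?thesis by (intro borel_measurable_continuous_onI) simp
qed

lemma compact_triples: "compact (UNIV :: ('s \<times> 's \<times> 'u) set)"
  using compact_Times[OF S_compact compact_Times[OF S_compact U_compact]] by simp

text \<open>A positive continuous function on the compact space of triples attains a positive
  minimum and a maximum. The minorization constant and all other uniform constants descend from
  \<open>c\<close> and \<open>C\<close>.\<close>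

lemma weight_bounds:
  obtains c C where "0 < c" and "c \<le> C"
    and "\<And>y x u. c \<le> exp (k x u) * \<phi> y x u" and "\<And>y x u. exp (k x u) * \<phi> y x u \<le> C"
proof -
  have pos: "0 < (case z of (y, x, u) \<Rightarrow> exp (k x u) * \<phi> y x u)" for z
    using \<phi>_pos by (cases z) auto
  show thesis
  proof (rule continuous_bounds_pos[OF compact_triples weight_cont pos])
    fix c C :: real
    assume c: "0 < c" "c \<le> C"
      and lo: "\<And>z. c \<le> (case z of (y, x, u) \<Rightarrow> exp (k x u) * \<phi> y x u)"
      and hi: "\<And>z. (case z of (y, x, u) \<Rightarrow> exp (k x u) * \<phi> y x u) \<le> C"
    show thesis
    proof (rule that[OF c])
      fix y x u
      show "c \<le> exp (k x u) * \<phi> y x u" "exp (k x u) * \<phi> y x u \<le> C"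
        using lo[of "(y, x, u)"] hi[of "(y, x, u)"] by simp_all
    qed
  qed
qed

text \<open>Since \<open>\<phi>\<close> is bounded below by some \<open>a > 0\<close> and integrates
  to 1 for any fixed state and control, the total mass of \<open>\<gamma>\<close> is at most
  \<open>1 / a\<close>. The point \<open>undefined\<close> is just an arbitrary choice of state and
  control.\<close>

lemma finite_\<gamma>: "finite_measure \<gamma>"
proof
  obtain c C where c: "0 < c" "c \<le> C" and le: "\<And>y x u. c \<le> exp (k x u) * \<phi> y x u"
    using weight_bounds by metis
  interpret p: prob_space "ctrl_kernel \<gamma> \<phi> undefined undefined" by (rule p_prob)
  define a where "a = c / exp (k undefined undefined)"
  have "0 < a" using c by (simp add: a_def)
  have a_le: "a \<le> \<phi> y undefined undefined" for y
    using le[of undefined undefined y] by (simp add: a_def field_simps)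
  have "ennreal a * emeasure \<gamma> (space \<gamma>) = (\<integral>\<^sup>+y. ennreal a \<partial>\<gamma>)" by simp
  also have "\<dots> \<le> (\<integral>\<^sup>+y. ennreal (\<phi> y undefined undefined) * indicator (space \<gamma>) y \<partial>\<gamma>)"
    using a_le by (intro nn_integral_mono) (auto intro!: ennreal_leI simp: space_\<gamma>)
  also have "\<dots> = 1"
    using p.emeasure_space_1 \<phi>_measurable[of undefined undefined]
    by (simp add: ctrl_kernel_def emeasure_density measurable_cong_sets[OF \<gamma>_sets refl])
  finally show "emeasure \<gamma> (space \<gamma>) \<noteq> \<infinity>"
    using \<open>0 < a\<close> by (auto simp: ennreal_mult_top top_unique)
qed

sublocale finite_measure \<gamma>
  by (rule finite_\<gamma>)

lemma \<gamma>_nonnull: "0 < measure \<gamma> (space \<gamma>)"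
proof -
  have "0 < emeasure \<gamma> UNIV" using \<gamma>_support by (auto simp: full_support_def)
  then show ?thesis
    by (simp add: space_\<gamma> emeasure_eq_measure)
qed

lemma integral_pos:
  fixes f :: "'s \<Rightarrow> real"
  assumes "integrable \<gamma> f" and "\<And>x. 0 < f x"
  shows "0 < (\<integral>y. f y \<partial>\<gamma>)"
proof -
  have "\<not> (AE x in \<gamma>. f x = 0)"
  proof
    assume "AE x in \<gamma>. f x = 0"
    moreover have "f x = 0 \<longleftrightarrow> False" for x using assms(2)[of x] by simp
    ultimately have "AE x in \<gamma>. False" by simp
    then show False
      using \<gamma>_nonnull ae_filter_eq_bot_iff[of \<gamma>] trivial_limit_def[of "ae_filter \<gamma>"]
      by (simp add: measure_def)
  qed
  then have "(\<integral>y. f y \<partial>\<gamma>) \<noteq> 0"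
    using integral_nonneg_eq_0_iff_AE[OF assms(1) AE_I2[OF less_imp_le[OF assms(2)]]] by blast
  moreover have "0 \<le> (\<integral>y. f y \<partial>\<gamma>)"
    using less_imp_le[OF assms(2)] by (rule Bochner_Integration.integral_nonneg)
  ultimately show ?thesis by linarith
qed

text \<open>Full support enters here: the set where \<open>f\<close> is positive is open and
  nonempty, hence not null. This serves solutions of the equation, which are only known to be
  nonnegative beforehand.\<close>

lemma integral_pos_continuous:
  fixes f :: "'s \<Rightarrow> real"
  assumes "continuous_on UNIV f" and nonneg: "\<And>x. 0 \<le> f x" and "f x \<noteq> 0"
  shows "0 < (\<integral>y. f y \<partial>\<gamma>)"
proof -
  obtain b where b: "\<And>y. f y \<le> b"
    using continuous_attains_sup[OF S_compact _ assms(1)] by auto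
  have [measurable]: "f \<in> borel_measurable borel"
    using assms(1) by (rule borel_measurable_continuous_onI)
  have int: "integrable \<gamma> f"
    using nonneg b by (intro integrable_const_bound[of _ b]) auto
  have "open {y. 0 < f y}"
    using assms(1) by (intro open_Collect_less) (auto intro!: continuous_intros)
  moreover have "x \<in> {y. 0 < f y}" using nonneg[of x] assms(3) by simp
  ultimately have "0 < emeasure \<gamma> {y. 0 < f y}"
    using \<gamma>_support by (auto simp: full_support_def)
  moreover have "{y \<in> space \<gamma>. \<not> f y = 0} = {y. 0 < f y}"
    using nonneg by (auto simp: space_\<gamma> less_le)
  ultimately have "\<not> (AE y in \<gamma>. f y = 0)"
    using AE_iff_measurable[of "{y. 0 < f y}" \<gamma> "\<lambda>y. f y = 0"] by simp
  then have "(\<integral>y. f y \<partial>\<gamma>) \<noteq> 0"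
    using integral_nonneg_eq_0_iff_AE[OF int AE_I2[OF nonneg]] by blast
  moreover have "0 \<le> (\<integral>y. f y \<partial>\<gamma>)"
    using nonneg by (rule Bochner_Integration.integral_nonneg)
  ultimately show ?thesis by linarith
qed

lemma borel_measurable_if_integrable: "integrable \<gamma> f \<Longrightarrow> f \<in> borel_measurable borel"
  using borel_measurable_integrable[of \<gamma> f] unfolding measurable_cong_sets[OF \<gamma>_sets refl] .

lemma weight_integrable:
  assumes f: "integrable \<gamma> f"
  shows "integrable \<gamma> (\<lambda>y. exp (k x u) * \<phi> y x u * f y)"
proof -
  obtain c C where c: "0 < c" "c \<le> C"
    and le: "\<And>y x u. c \<le> exp (k x u) * \<phi> y x u" "\<And>y x u. exp (k x u) * \<phi> y x u \<le> C"
    using weight_bounds by metis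
  have "\<bar>exp (k x u) * \<phi> y x u\<bar> \<le> C" for y
    using c le[of x u y] by simp
  then have bound: "norm (exp (k x u) * \<phi> y x u * f y) \<le> norm (C * f y)" for y
    using c unfolding real_norm_def abs_mult[of _ "f y"] by (intro mult_right_mono) auto
  show ?thesis
  proof (rule Bochner_Integration.integrable_bound)
    show "integrable \<gamma> (\<lambda>y. C * f y)"
      using f by (rule integrable_mult_right)
    show "(\<lambda>y. exp (k x u) * \<phi> y x u * f y) \<in> borel_measurable \<gamma>"
      unfolding measurable_cong_sets[OF \<gamma>_sets refl, of borel]
      by (rule borel_measurable_times[OF weight_measurable borel_measurable_if_integrable[OF f]])
    show "AE y in \<gamma>. norm (exp (k x u) * \<phi> y x u * f y) \<le> norm (C * f y)"
      using bound by (rule AE_I2)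
  qed
qed

text \<open>The regularity comes from the weight, while \<open>f\<close> is merely integrable.
  Sequential continuity suffices on the metrizable product, and dominated convergence applies with
  the majorant \<open>C * \<bar>f y\<bar>\<close>.\<close>

lemma Q_cont:
  assumes f: "integrable \<gamma> f"
  shows "continuous_on UNIV (\<lambda>(x, u). Q f x u)"
proof -
  obtain c C where c: "0 < c" "c \<le> C"
    and le: "\<And>y x u. c \<le> exp (k x u) * \<phi> y x u" "\<And>y x u. exp (k x u) * \<phi> y x u \<le> C"
    using weight_bounds by metis
  have "(\<lambda>n. Q f (fst (z n)) (snd (z n))) \<longlonglongrightarrow> Q f (fst w) (snd w)" if z: "z \<longlonglongrightarrow> w" for z w
  proof (rule integral_dominated_convergence[where w = "\<lambda>y. C * \<bar>f y\<bar>"])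
    show "AE y in \<gamma>. (\<lambda>n. exp (k (fst (z n)) (snd (z n))) * \<phi> y (fst (z n)) (snd (z n)) * f y)
        \<longlonglongrightarrow> exp (k (fst w) (snd w)) * \<phi> y (fst w) (snd w) * f y"
    proof (intro AE_I2 tendsto_mult_right)
      fix y :: 's
      have "(\<lambda>n. (y, z n)) \<longlonglongrightarrow> (y, w)" by (rule tendsto_Pair[OF tendsto_const z])
      from continuous_on_tendsto_compose[OF weight_cont this UNIV_I always_eventually]
      show "(\<lambda>n. exp (k (fst (z n)) (snd (z n))) * \<phi> y (fst (z n)) (snd (z n)))
        \<longlonglongrightarrow> exp (k (fst w) (snd w)) * \<phi> y (fst w) (snd w)"
        unfolding case_prod_unfold fst_conv snd_conv by blast
    qed
    fix n
    have "\<bar>exp (k (fst (z n)) (snd (z n))) * \<phi> y (fst (z n)) (snd (z n))\<bar> \<le> C" for y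
      using c le[of "fst (z n)" "snd (z n)" y] by simp
    then show "AE y in \<gamma>. norm (exp (k (fst (z n)) (snd (z n))) * \<phi> y (fst (z n)) (snd (z n)) * f y)
        \<le> C * \<bar>f y\<bar>"
      by (intro AE_I2) (simp only: real_norm_def abs_mult[of _ "f _"] mult_right_mono abs_ge_zero)
    show "(\<lambda>y. exp (k (fst (z n)) (snd (z n))) * \<phi> y (fst (z n)) (snd (z n)) * f y) \<in> borel_measurable \<gamma>"
      by (rule borel_measurable_integrable[OF weight_integrable[OF f]])
  next
    show "(\<lambda>y. exp (k (fst w) (snd w)) * \<phi> y (fst w) (snd w) * f y) \<in> borel_measurable \<gamma>"
      by (rule borel_measurable_integrable[OF weight_integrable[OF f]])
    show "integrable \<gamma> (\<lambda>y. C * \<bar>f y\<bar>)"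
      using f by (intro integrable_mult_right integrable_abs)
  qed
  note lim = this
  show ?thesis
    unfolding continuous_on_sequentially case_prod_unfold comp_def
  proof (intro allI ballI impI)
    fix z :: "nat \<Rightarrow> 's \<times> 'u" and w
    assume "(\<forall>n. z n \<in> UNIV) \<and> z \<longlonglongrightarrow> w"
    then have "z \<longlonglongrightarrow> w" ..
    then show "(\<lambda>n. Q f (fst (z n)) (snd (z n))) \<longlonglongrightarrow> Q f (fst w) (snd w)"
      by (rule lim)
  qed
qed

lemma Q_cont1:
  assumes "integrable \<gamma> f"
  shows "continuous_on UNIV (\<lambda>x. Q f x u)"
proof -
  have "continuous_on UNIV (\<lambda>x::'s. (x, u))" by (intro continuous_intros)
  from continuous_on_compose2[OF Q_cont[OF assms] this subset_UNIV] show ?thesis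
    unfolding prod.case .
qed

lemma Q_cont2:
  assumes "integrable \<gamma> f"
  shows "continuous_on UNIV (Q f x)"
proof -
  have "continuous_on UNIV (\<lambda>u::'u. (x, u))" by (intro continuous_intros)
  from continuous_on_compose2[OF Q_cont[OF assms] this subset_UNIV] show ?thesis
    unfolding prod.case .
qed

lemma bellman_le: "integrable \<gamma> f \<Longrightarrow> bellman f x \<le> Q f x u"
  unfolding bellman_def by (rule min_over_attained(2)[OF U_compact Q_cont2])

lemma bellman_attained: "integrable \<gamma> f \<Longrightarrow> \<exists>u. bellman f x = Q f x u"
  using min_over_attained(1)[OF U_compact Q_cont2, of f x] unfolding bellman_def by auto

lemma bellman_measurable:
  assumes "integrable \<gamma> f"
  shows "bellman f \<in> borel_measurable borel"
proof (rule borel_measurableI_ge)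
  fix a
  \<comment> \<open>The minimum runs over a possibly uncountable family. Because it is attained, a
    superlevel set is an intersection of closed sets, so \<open>bellman f\<close> is upper
    semicontinuous.\<close>
  have "{x. a \<le> bellman f x} = (\<Inter>u. {x. a \<le> Q f x u})"
  proof (intro set_eqI iffI)
    fix x assume "x \<in> (\<Inter>u. {x. a \<le> Q f x u})"
    moreover obtain u where "bellman f x = Q f x u" using bellman_attained[OF assms] by blast
    ultimately show "x \<in> {x. a \<le> bellman f x}" by simp
  next
    fix x assume "x \<in> {x. a \<le> bellman f x}"
    then show "x \<in> (\<Inter>u. {x. a \<le> Q f x u})"
      using bellman_le[OF assms, of x] by (auto intro: order_trans)
  qed
  moreover have "closed (\<Inter>u. {x. a \<le> Q f x u})"
    using Q_cont1[OF assms] by (intro closed_INT ballI closed_Collect_le continuous_on_const) auto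
  ultimately show "{x \<in> space borel. a \<le> bellman f x} \<in> sets borel" by simp
qed

lemma bellman_scale:
  assumes "integrable \<gamma> f" and "0 \<le> a"
  shows "bellman (\<lambda>y. a * f y) x = a * bellman f x"
proof -
  have Q: "Q (\<lambda>y. a * f y) x u = a * Q f x u" for u
    by (subst integral_mult_right_zero[symmetric]) (simp add: mult_ac)
  obtain u where "bellman f x = Q f x u" using bellman_attained[OF assms(1)] by blast
  then have "min_over (\<lambda>u. a * Q f x u) = a * bellman f x"
    by (intro min_over_eqI[of _ u] mult_left_mono[OF bellman_le[OF assms(1)] assms(2)]) simp
  then show ?thesis
    unfolding bellman_def[of "\<lambda>y. a * f y"] Q .
qed

text \<open>The bounds on the weight transfer to \<open>Q\<close> and then to its minimum. The
  constants depend neither on \<open>f\<close> nor on \<open>x\<close>: one application of the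
  operator makes a merely integrable positive function comparable to a constant.\<close>

lemma bellman_bounds:
  obtains c C where "0 < c"
    and "\<And>f x. integrable \<gamma> f \<Longrightarrow> (\<And>y. 0 \<le> f y) \<Longrightarrow> c * (\<integral>y. f y \<partial>\<gamma>) \<le> bellman f x"
    and "\<And>f x. integrable \<gamma> f \<Longrightarrow> (\<And>y. 0 \<le> f y) \<Longrightarrow> bellman f x \<le> C * (\<integral>y. f y \<partial>\<gamma>)"
proof -
  obtain c C where c: "0 < c" "c \<le> C"
    and le: "\<And>y x u. c \<le> exp (k x u) * \<phi> y x u" "\<And>y x u. exp (k x u) * \<phi> y x u \<le> C"
    using weight_bounds by metis
  have Q: "c * (\<integral>y. f y \<partial>\<gamma>) \<le> Q f x u" "Q f x u \<le> C * (\<integral>y. f y \<partial>\<gamma>)"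
    if f: "integrable \<gamma> f" and nonneg: "\<And>y. 0 \<le> f y" for f x u
  proof -
    have "(\<integral>y. c * f y \<partial>\<gamma>) \<le> Q f x u" "Q f x u \<le> (\<integral>y. C * f y \<partial>\<gamma>)"
      by (rule integral_mono; use f nonneg weight_integrable[OF f] le in \<open>simp add: mult_right_mono\<close>)+
    then show "c * (\<integral>y. f y \<partial>\<gamma>) \<le> Q f x u" "Q f x u \<le> C * (\<integral>y. f y \<partial>\<gamma>)" by simp_all
  qed
  show thesis
  proof (rule that[OF c(1)])
    fix f :: "'s \<Rightarrow> real" and x
    assume f: "integrable \<gamma> f" "\<And>y. 0 \<le> f y"
    show "c * (\<integral>y. f y \<partial>\<gamma>) \<le> bellman f x" "bellman f x \<le> C * (\<integral>y. f y \<partial>\<gamma>)"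
      using bellman_attained[OF f(1), of x] Q[OF f, of x] by auto
  qed
qed

lemma bellman_pos:
  assumes "integrable \<gamma> f" and "\<And>y. 0 < f y"
  shows "0 < bellman f x"
proof -
  obtain c where "0 < c" and "\<And>f x. integrable \<gamma> f \<Longrightarrow> (\<And>y. 0 \<le> f y) \<Longrightarrow> c * (\<integral>y. f y \<partial>\<gamma>) \<le> bellman f x"
    using bellman_bounds by metis
  then show ?thesis
    using integral_pos[OF assms] assms by (smt (verit) mult_pos_pos)
qed

lemma bellman_integrable:
  assumes "integrable \<gamma> f" and "\<And>y. 0 < f y"
  shows "integrable \<gamma> (bellman f)"
proof -
  have [measurable]: "bellman f \<in> borel_measurable borel"
    using assms(1) by (rule bellman_measurable)
  obtain C where "\<And>f x. integrable \<gamma> f \<Longrightarrow> (\<And>y. 0 \<le> f y) \<Longrightarrow> bellman f x \<le> C * (\<integral>y. f y \<partial>\<gamma>)"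
    using bellman_bounds by metis
  then show ?thesis
    using assms bellman_pos[OF assms]
    by (intro integrable_const_bound[of _ "C * (\<integral>y. f y \<partial>\<gamma>)"]) (auto simp: less_imp_le intro!: AE_I2)
qed

text \<open>Two forms are needed, since the exponential stands outside the integral in
  \<open>dp_solution\<close> and inside it in the iterations.\<close>

lemma integral_ctrl_kernel:
  assumes [measurable]: "f \<in> borel_measurable borel"
  shows "exp (k x u) * (\<integral>y. f y \<partial>ctrl_kernel \<gamma> \<phi> x u) = Q f x u"
    and "(\<integral>y. exp (k x u) * f y \<partial>ctrl_kernel \<gamma> \<phi> x u) = Q f x u"
proof -
  show "exp (k x u) * (\<integral>y. f y \<partial>ctrl_kernel \<gamma> \<phi> x u) = Q f x u"
    unfolding ctrl_kernel_def using \<phi>_pos[of _ x u]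
    by (subst integral_density) (auto simp: less_imp_le mult.assoc)
  then show "(\<integral>y. exp (k x u) * f y \<partial>ctrl_kernel \<gamma> \<phi> x u) = Q f x u" by simp
qed

section \<open>Value iterates and relative value iterates\<close>

abbreviation J :: "('s \<Rightarrow> real) \<Rightarrow> nat \<Rightarrow> 's \<Rightarrow> real" where
  "J J0 \<equiv> value_iter (ctrl_kernel \<gamma> \<phi>) k \<Lambda> J0"

text \<open>Integrability and positivity are carried through one induction because each step depends
  on them: measurability of the iterate permits rewriting its definition with
  \<open>bellman\<close>, which in turn preserves both properties.\<close>

lemma value_iter_props:
  assumes "integrable \<gamma> J0" and "\<And>x. 0 < J0 x"
  shows "integrable \<gamma> (J J0 n)" and "0 < J J0 n x" and "J J0 (Suc n) x = 1 / \<Lambda> * bellman (J J0 n) x"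
proof -
  have step: "J J0 (Suc n) x = 1 / \<Lambda> * bellman (J J0 n) x" if "integrable \<gamma> (J J0 n)" for n x
    using borel_measurable_if_integrable[OF that] by (simp add: bellman_def integral_ctrl_kernel)
  have props: "integrable \<gamma> (J J0 n) \<and> (\<forall>x. 0 < J J0 n x)" for n
  proof (induction n)
    case 0
    then show ?case using assms by simp
  next
    case (Suc n)
    have "J J0 (Suc n) = (\<lambda>x. 1 / \<Lambda> * bellman (J J0 n) x)"
      using Suc by (intro ext step) simp
    then show ?case
      using Suc bellman_integrable[of "J J0 n"] bellman_pos[of "J J0 n"] \<Lambda>_pos by simp
  qed
  then show "integrable \<gamma> (J J0 n)" and "0 < J J0 n x" by blast+
  show "J J0 (Suc n) x = 1 / \<Lambda> * bellman (J J0 n) x"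
    using props step by blast
qed

text \<open>Each relative iterate is a positive multiple of the corresponding value iterate. By
  homogeneity of \<open>bellman\<close>, the multiple \<open>a\<close> cancels against the
  normalization at \<open>x0\<close>, so its value is irrelevant for the next iterate.\<close>

lemma rel_value_iter_eq:
  assumes "integrable \<gamma> J0" and "\<And>x. 0 < J0 x"
  shows "rel_value_iter (ctrl_kernel \<gamma> \<phi>) k x0 J0 (Suc n) x = \<Lambda> * J J0 (Suc n) x / J J0 n x0"
proof -
  note J = value_iter_props[OF assms]
  let ?R = "rel_value_iter (ctrl_kernel \<gamma> \<phi>) k x0 J0"
  have step: "?R (Suc n) x = \<Lambda> * J J0 (Suc n) x / J J0 n x0"
    if R: "?R n = (\<lambda>y. a * J J0 n y)" and a: "0 < a" for a n x
  proof -
    have [measurable]: "J J0 n \<in> borel_measurable borel"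
      by (rule borel_measurable_if_integrable[OF J(1)])
    have "?R (Suc n) x = 1 / (a * J J0 n x0) * bellman (\<lambda>y. a * J J0 n y) x"
      unfolding rel_value_iter.simps R bellman_def
      by (subst integral_ctrl_kernel(2)) (rule borel_measurable_if_integrable[OF integrable_mult_right[OF J(1)]], rule refl)
    also have "\<dots> = \<Lambda> * J J0 (Suc n) x / J J0 n x0"
      using a \<Lambda>_pos by (simp only: bellman_scale[OF J(1) less_imp_le[OF a]] J(3)) simp
    finally show ?thesis .
  qed
  have "\<exists>a>0. ?R n = (\<lambda>y. a * J J0 n y)"
  proof (induction n)
    case 0
    then show ?case by (intro exI[of _ 1]) simp
  next
    case (Suc n)
    then obtain a where "0 < a" "?R n = (\<lambda>y. a * J J0 n y)" by blast
    \<comment> \<open>The formula for one step exhibits the next multiple,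
      \<open>\<Lambda> / J J0 n x0\<close>.\<close>
    then have "?R (Suc n) = (\<lambda>x. \<Lambda> / J J0 n x0 * J J0 (Suc n) x)"
      by (intro ext) (simp only: step times_divide_eq_left)
    then show ?case
      using J(2)[of n x0] \<Lambda>_pos by (intro exI[of _ "\<Lambda> / J J0 n x0"]) simp
  qed
  then show ?thesis using step by blast
qed

section \<open>Solutions of the dynamic programming equation\<close>

lemma dp_solutionD:
  assumes "dp_solution (ctrl_kernel \<gamma> \<phi>) k \<Lambda> W"
  shows "continuous_on UNIV W" and "0 \<le> W x" and "integrable \<gamma> W" and "\<Lambda> * W x = bellman W x"
proof -
  show cont: "continuous_on UNIV W" and nonneg: "0 \<le> W x" for x
    using assms by (auto simp: dp_solution_def)
  have [measurable]: "W \<in> borel_measurable borel"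
    using cont by (rule borel_measurable_continuous_onI)
  obtain b where b: "\<And>x. W x \<le> b"
    using continuous_attains_sup[OF S_compact _ cont] by auto
  show "integrable \<gamma> W"
    by (rule integrable_const_bound[of _ b]) (use nonneg b in auto)
  show "\<Lambda> * W x = bellman W x"
    using assms by (simp add: dp_solution_def bellman_def integral_ctrl_kernel(1))
qed

text \<open>By continuity and full support, one nonzero value makes the integral of \<open>W\<close>
  positive. The lower bound for \<open>bellman\<close> spreads this positivity to every
  state.\<close>

lemma dp_solution_pos:
  assumes sol: "dp_solution (ctrl_kernel \<gamma> \<phi>) k \<Lambda> W" and "W z \<noteq> 0"
  shows "0 < W x"
proof -
  note W = dp_solutionD[OF sol]
  obtain c where "0 < c"
    and "\<And>f x. integrable \<gamma> f \<Longrightarrow> (\<And>y. 0 \<le> f y) \<Longrightarrow> c * (\<integral>y. f y \<partial>\<gamma>) \<le> bellman f x"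
    using bellman_bounds by metis
  then have "c * (\<integral>y. W y \<partial>\<gamma>) \<le> \<Lambda> * W x"
    using W by simp
  moreover have "0 < c * (\<integral>y. W y \<partial>\<gamma>)"
    using \<open>0 < c\<close> integral_pos_continuous[OF W(1,2) assms(2)] by simp
  ultimately have "0 < \<Lambda> * W x" by linarith
  then show ?thesis using \<Lambda>_pos by (simp add: zero_less_mult_iff)
qed

lemma dp_solution_scale:
  assumes sol: "dp_solution (ctrl_kernel \<gamma> \<phi>) k \<Lambda> W" and "0 \<le> a"
  shows "dp_solution (ctrl_kernel \<gamma> \<phi>) k \<Lambda> (\<lambda>x. a * W x)"
proof -
  note W = dp_solutionD[OF sol]
  have meas: "(\<lambda>x. a * W x) \<in> borel_measurable borel"
    using borel_measurable_if_integrable[OF W(3)] by simp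
  have "\<Lambda> * (a * W x) = min_over (Q (\<lambda>x. a * W x) x)" for x
    using bellman_scale[OF W(3) assms(2), of x] W(4)[of x] by (simp add: bellman_def)
  moreover have "continuous_on UNIV (\<lambda>x. a * W x)"
    using W(1) by (intro continuous_intros)
  ultimately show ?thesis
    unfolding dp_solution_def integral_ctrl_kernel(1)[OF meas] using W(2) assms(2) by simp
qed

end

section \<open>Ratios of the iterates to \<open>V\<close> and their limit\<close>

locale multiplicative_dp_solution = multiplicative_dp \<gamma> \<phi> k \<Lambda>
  for \<gamma> :: "'s::polish_space measure" and \<phi> :: "'s \<Rightarrow> 's \<Rightarrow> 'u::metric_space \<Rightarrow> real" and k \<Lambda> +
  fixes V :: "'s \<Rightarrow> real"
  assumes V_sol: "dp_solution (ctrl_kernel \<gamma> \<phi>) k \<Lambda> V"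
    and V_nonzero: "\<exists>x. V x \<noteq> 0"
begin

lemmas V_cont = dp_solutionD(1)[OF V_sol]
  and V_integrable = dp_solutionD(3)[OF V_sol]
  and V_eq = dp_solutionD(4)[OF V_sol]

lemma V_pos: "0 < V x"
  using dp_solution_pos[OF V_sol] V_nonzero by blast

lemma V_bounds:
  obtains a b where "0 < a" and "a \<le> b" and "\<And>x. a \<le> V x" and "\<And>x. V x \<le> b"
  by (rule continuous_bounds_pos[OF S_compact V_cont V_pos]) blast

lemma divide_V_integrable:
  assumes "integrable \<gamma> f"
  shows "integrable \<gamma> (\<lambda>y. f y / V y)"
proof -
  obtain a where a: "0 < a" "\<And>x. a \<le> V x"
    using V_bounds by metis
  show ?thesis
  proof (rule Bochner_Integration.integrable_bound)
    show "integrable \<gamma> (\<lambda>y. f y / a)"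
      using assms by simp
    have [measurable]: "f \<in> borel_measurable borel" "V \<in> borel_measurable borel"
      using borel_measurable_if_integrable assms V_integrable by auto
    show "(\<lambda>y. f y / V y) \<in> borel_measurable \<gamma>" by measurable
    have "norm (f y / V y) \<le> norm (f y / a)" for y
      using a(1) a(2)[of y] by (simp add: frac_le)
    then show "AE y in \<gamma>. norm (f y / V y) \<le> norm (f y / a)"
      by (rule AE_I2)
  qed
qed

text \<open>This is \<open>q\<close> of the opening outline. At the control \<open>v x\<close> it is
  the density of the optimal kernel with respect to \<open>\<gamma>\<close>, see
  \<open>opt_kernel_eq\<close>.\<close>

definition ratio_density :: "'s \<Rightarrow> 'u \<Rightarrow> 's \<Rightarrow> real" where
  "ratio_density x u y = exp (k x u) * \<phi> y x u * V y / (\<Lambda> * V x)"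

text \<open>The weight and \<open>V\<close> are both bounded away from 0 and from above. The lower
  bound is the minorization constant; the upper bound \<open>D\<close> later dominates the laws of
  the stationary chain.\<close>

lemma ratio_density_bounds:
  obtains \<delta> D where "0 < \<delta>" and "\<And>x u y. \<delta> \<le> ratio_density x u y"
    and "\<And>x u y. ratio_density x u y \<le> D"
proof -
  obtain c C where c: "0 < c" "c \<le> C"
    and le: "\<And>y x u. c \<le> exp (k x u) * \<phi> y x u" "\<And>y x u. exp (k x u) * \<phi> y x u \<le> C"
    using weight_bounds by metis
  obtain a b where a: "0 < a" "a \<le> b" and V: "\<And>x. a \<le> V x" "\<And>x. V x \<le> b"
    using V_bounds by metis
  show thesis
  proof (rule that)
    show "0 < c * a / (\<Lambda> * b)" using c a \<Lambda>_pos by simp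
    fix x u y
    have "c * a \<le> exp (k x u) * \<phi> y x u * V y" "exp (k x u) * \<phi> y x u * V y \<le> C * b"
      using c a le[of x u y] V[of y] by (auto intro!: mult_mono)
    moreover have "\<Lambda> * V x \<le> \<Lambda> * b" "\<Lambda> * a \<le> \<Lambda> * V x" "0 < \<Lambda> * V x" "0 < \<Lambda> * a"
      using V[of x] \<Lambda>_pos V_pos a by auto
    moreover have "0 < c * a" using c a by simp
    ultimately show "c * a / (\<Lambda> * b) \<le> ratio_density x u y" "ratio_density x u y \<le> C * b / (\<Lambda> * a)"
      unfolding ratio_density_def by (auto intro!: frac_le)
  qed
qed

text \<open>The factor \<open>V y\<close> in the density cancels the denominator of the ratio,
  leaving the integrand of \<open>Q f x u\<close>.\<close>

lemma ratio_density_integral: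
  assumes "integrable \<gamma> f"
  shows "integrable \<gamma> (\<lambda>y. ratio_density x u y * (f y / V y))"
    and "(\<integral>y. ratio_density x u y * (f y / V y) \<partial>\<gamma>) = Q f x u / (\<Lambda> * V x)"
proof -
  have eq: "ratio_density x u y * (f y / V y) = exp (k x u) * \<phi> y x u * f y / (\<Lambda> * V x)" for y
    using V_pos[of y] by (simp add: ratio_density_def)
  show "integrable \<gamma> (\<lambda>y. ratio_density x u y * (f y / V y))"
    unfolding eq by (rule integrable_divide_zero) (use weight_integrable[OF assms] in simp)
  show "(\<integral>y. ratio_density x u y * (f y / V y) \<partial>\<gamma>) = Q f x u / (\<Lambda> * V x)"
    unfolding eq by simp
qed

lemma ratio_density_mass:
  shows "integrable \<gamma> (ratio_density x u)"
    and "(\<integral>y. ratio_density x u y \<partial>\<gamma>) = Q V x u / (\<Lambda> * V x)"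
proof -
  have eq: "(\<lambda>y. ratio_density x u y * (V y / V y)) = ratio_density x u"
    using less_imp_neq[OF V_pos] by (intro ext) simp
  show "integrable \<gamma> (ratio_density x u)"
    and "(\<integral>y. ratio_density x u y \<partial>\<gamma>) = Q V x u / (\<Lambda> * V x)"
    using ratio_density_integral[OF V_integrable, of x u] unfolding eq by blast+
qed

text \<open>Holds at every control by minimality. Besides the contraction, it serves at
  \<open>u = v x\<close> as the source of the submartingale inequality.\<close>

lemma value_iter_ratio_le:
  assumes "integrable \<gamma> J0" and "\<And>x. 0 < J0 x"
  shows "J J0 (Suc n) x / V x \<le> (\<integral>y. ratio_density x u y * (J J0 n y / V y) \<partial>\<gamma>)"
proof -
  note J = value_iter_props[OF assms]
  have "J J0 (Suc n) x / V x = bellman (J J0 n) x / (\<Lambda> * V x)"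
    unfolding J(3) by simp
  also have "\<dots> \<le> Q (J J0 n) x u / (\<Lambda> * V x)"
    using \<Lambda>_pos V_pos[of x] by (intro divide_right_mono bellman_le[OF J(1)]) simp
  finally show ?thesis
    unfolding ratio_density_integral(2)[OF J(1)] .
qed

text \<open>The contraction starts at \<open>J J0 (Suc 0)\<close>, hence the shift in the index. The
  initial function is only positive and integrable, whereas one Bellman step yields a ratio with
  positive lower and finite upper bounds.\<close>

lemma value_iter_ratio_limit:
  assumes J0: "integrable \<gamma> J0" "\<And>x. 0 < J0 x"
  obtains c e where "0 < c" and "e \<longlonglongrightarrow> 0" and "\<And>n x. \<bar>J J0 (Suc n) x / V x - c\<bar> \<le> e n"
proof -
  note J = value_iter_props[OF J0]
  obtain \<delta> where \<delta>: "0 < \<delta>" "\<And>x u y. \<delta> \<le> ratio_density x u y"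
    using ratio_density_bounds by metis
  obtain c C where c: "0 < c"
    and le: "\<And>f x. integrable \<gamma> f \<Longrightarrow> (\<And>y. 0 \<le> f y) \<Longrightarrow> c * (\<integral>y. f y \<partial>\<gamma>) \<le> bellman f x"
      "\<And>f x. integrable \<gamma> f \<Longrightarrow> (\<And>y. 0 \<le> f y) \<Longrightarrow> bellman f x \<le> C * (\<integral>y. f y \<partial>\<gamma>)"
    using bellman_bounds by metis
  obtain a b where a: "0 < a" "a \<le> b" and V: "\<And>x. a \<le> V x" "\<And>x. V x \<le> b"
    using V_bounds by metis
  let ?I = "\<integral>y. J0 y \<partial>\<gamma>"
  have I: "0 < ?I" by (rule integral_pos[OF J0])
  have J0_nonneg: "0 \<le> J0 y" for y using J0(2)[of y] by simp
  have J1: "J J0 (Suc 0) x / V x = bellman J0 x / (\<Lambda> * V x)" for x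
    unfolding J(3) by simp
  have attained: "\<exists>u. J J0 (Suc n) x / V x = (\<integral>y. ratio_density x u y * (J J0 n y / V y) \<partial>\<gamma>)" for n x
  proof -
    obtain u where "bellman (J J0 n) x = Q (J J0 n) x u" using bellman_attained[OF J(1)] by blast
    then show ?thesis
      unfolding J(3) ratio_density_integral(2)[OF J(1)] by (intro exI[of _ u]) simp
  qed
  interpret weighted_min_iteration \<gamma> ratio_density \<delta> "\<lambda>n x. J J0 (Suc n) x / V x"
  proof
    fix x u n
    show "integrable \<gamma> (ratio_density x u)" by (rule ratio_density_mass)
    \<comment> \<open>Mass at least 1 is the minimality half of the equation for \<open>V\<close>;
      mass equal to 1 at some control, the next claim, is its attainment half.\<close>
    show "1 \<le> (\<integral>y. ratio_density x u y \<partial>\<gamma>)"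
      unfolding ratio_density_mass
      using bellman_le[OF V_integrable, of x u] V_eq[of x] mult_pos_pos[OF \<Lambda>_pos V_pos[of x]]
      by (simp add: le_divide_eq)
    show "\<exists>u. (\<integral>y. ratio_density x u y \<partial>\<gamma>) = 1"
    proof -
      obtain w where "bellman V x = Q V x w" using bellman_attained[OF V_integrable] by blast
      then show ?thesis
        unfolding ratio_density_mass V_eq[symmetric]
        using mult_pos_pos[OF \<Lambda>_pos V_pos[of x]] V_eq[of x] by (intro exI[of _ w]) simp
    qed
    show "integrable \<gamma> (\<lambda>y. J J0 (Suc n) y / V y)" by (rule divide_V_integrable[OF J(1)])
    show "integrable \<gamma> (\<lambda>y. ratio_density x u y * (J J0 (Suc n) y / V y))"
      by (rule ratio_density_integral(1)[OF J(1)])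
    show "J J0 (Suc (Suc n)) x / V x \<le> (\<integral>y. ratio_density x u y * (J J0 (Suc n) y / V y) \<partial>\<gamma>)"
      by (rule value_iter_ratio_le[OF J0])
    show "\<exists>u. J J0 (Suc (Suc n)) x / V x = (\<integral>y. ratio_density x u y * (J J0 (Suc n) y / V y) \<partial>\<gamma>)"
      by (rule attained)
  qed (use \<delta> \<gamma>_nonnull in auto)
  have lo: "c * ?I / (\<Lambda> * b) \<le> J J0 (Suc 0) x / V x" for x
    unfolding J1
    using le(1)[OF J0(1) J0_nonneg, of x] less_imp_le[OF bellman_pos[OF J0, of x]] V[of x] a c I \<Lambda>_pos V_pos[of x]
    by (intro frac_le) auto
  have hi: "J J0 (Suc 0) x / V x \<le> C * ?I / (\<Lambda> * a)" for x
    unfolding J1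
    using le(2)[OF J0(1) J0_nonneg, of x] bellman_pos[OF J0, of x] V[of x] a \<Lambda>_pos V_pos[of x]
    by (intro frac_le) auto
  have "0 < c * ?I / (\<Lambda> * b)" using c I a \<Lambda>_pos by simp
  from uniform_limit_const[OF this lo hi] that show thesis by blast
qed

lemma value_iter_limit:
  assumes "0 < c" and "e \<longlonglongrightarrow> 0" and bound: "\<And>n x. \<bar>J J0 (Suc n) x / V x - c\<bar> \<le> e n"
  shows "(\<lambda>n. J J0 n x) \<longlonglongrightarrow> c * V x"
proof -
  have "(\<lambda>n. J J0 (Suc n) x / V x - c) \<longlonglongrightarrow> 0"
    by (rule Lim_null_comparison[OF _ assms(2)]) (use bound in auto)
  then have "(\<lambda>n. J J0 (Suc n) x / V x) \<longlonglongrightarrow> c"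
    by (simp only: LIM_zero_iff)
  from tendsto_mult_right[OF this, of "V x"] have "(\<lambda>n. J J0 (Suc n) x) \<longlonglongrightarrow> c * V x"
    using V_pos[of x] by simp
  then show ?thesis by (rule LIMSEQ_imp_Suc)
qed

text \<open>By \<open>rel_value_iter_eq\<close> the relative iterate is a quotient of value
  iterates, in which the unknown constant \<open>c\<close> cancels.\<close>

lemma rel_value_iter_limit:
  assumes J0: "integrable \<gamma> J0" "\<And>x. 0 < J0 x"
  shows "(\<lambda>n. rel_value_iter (ctrl_kernel \<gamma> \<phi>) k x0 J0 n x) \<longlonglongrightarrow> \<Lambda> / V x0 * V x"
proof -
  obtain c e where c: "0 < c" "e \<longlonglongrightarrow> 0" "\<And>n x. \<bar>J J0 (Suc n) x / V x - c\<bar> \<le> e n"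
    using value_iter_ratio_limit[OF J0] by metis
  note lim = value_iter_limit[OF c]
  have "(\<lambda>n. \<Lambda> * J J0 (Suc n) x / J J0 n x0) \<longlonglongrightarrow> \<Lambda> * (c * V x) / (c * V x0)"
    using c(1) V_pos[of x0] by (intro tendsto_intros LIMSEQ_Suc[OF lim] lim) simp
  moreover have "\<Lambda> * (c * V x) / (c * V x0) = \<Lambda> / V x0 * V x"
    using c(1) by simp
  ultimately have "(\<lambda>n. rel_value_iter (ctrl_kernel \<gamma> \<phi>) k x0 J0 (Suc n) x) \<longlonglongrightarrow> \<Lambda> / V x0 * V x"
    unfolding rel_value_iter_eq[OF J0] by simp
  then show ?thesis by (rule LIMSEQ_imp_Suc)
qed

text \<open>A solution \<open>W\<close> is a fixed point of the value iteration, so the iteration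
  started at \<open>W\<close> is constant. Its limit is also a multiple of \<open>V\<close>, and the
  value at \<open>x0\<close> determines the factor. Positivity of \<open>W\<close>, needed to start
  the iteration, follows from \<open>W x0 = \<Lambda>\<close>.\<close>

lemma dp_solution_unique:
  assumes sol: "dp_solution (ctrl_kernel \<gamma> \<phi>) k \<Lambda> W" and "W x0 = \<Lambda>"
  shows "W = (\<lambda>x. \<Lambda> / V x0 * V x)"
proof -
  note W = dp_solutionD[OF sol]
  have W_pos: "0 < W x" for x
    using dp_solution_pos[OF sol, of x0] assms(2) \<Lambda>_pos by simp
  have fixed: "J W n = W" for n
  proof (induction n)
    case (Suc n)
    have "J W (Suc n) x = W x" for x
      using value_iter_props(3)[OF W(3) W_pos, of n x] Suc W(4)[of x, symmetric] \<Lambda>_pos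
      by (simp del: value_iter.simps)
    then show ?case by blast
  qed simp
  obtain c e where c: "0 < c" "e \<longlonglongrightarrow> 0" "\<And>n x. \<bar>J W (Suc n) x / V x - c\<bar> \<le> e n"
    using value_iter_ratio_limit[OF W(3) W_pos] by metis
  have "W x = c * V x" for x
    using value_iter_limit[OF c, of x] LIMSEQ_const_iff unfolding fixed by blast
  then show ?thesis
    using assms(2) V_pos[of x0] by (auto simp: fun_eq_iff field_simps)
qed

end

section \<open>Conditional laws given by a kernel\<close>

lemma generated_sigma_generators:
  "{X i -` A \<inter> space M | i A. i \<in> I \<and> A \<in> sets borel} \<subseteq> Pow (space M)"
  by auto

lemma space_generated_sigma: "space (generated_sigma M X I) = space M"
  unfolding generated_sigma_def by (rule space_measure_of[OF generated_sigma_generators])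

lemma sets_generated_sigma:
  "sets (generated_sigma M X I) =
     sigma_sets (space M) {X i -` A \<inter> space M | i A. i \<in> I \<and> A \<in> sets borel}"
  unfolding generated_sigma_def by (rule sets_measure_of[OF generated_sigma_generators])

lemma subalgebra_generated_sigma:
  fixes X :: "'i \<Rightarrow> 'w \<Rightarrow> 's::topological_space"
  assumes "\<And>i. i \<in> I \<Longrightarrow> X i \<in> borel_measurable M"
  shows "subalgebra M (generated_sigma M X I)"
  unfolding subalgebra_def space_generated_sigma sets_generated_sigma
  using assms by (auto intro!: sets.sigma_sets_subset measurable_sets)

lemma subalgebra_generated_sigma_mono:
  assumes "I \<subseteq> I'"
  shows "subalgebra (generated_sigma M X I') (generated_sigma M X I)"
  unfolding subalgebra_def space_generated_sigma sets_generated_sigma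
  using assms by (auto intro!: sigma_sets_mono')

lemma measurable_generated_sigma:
  fixes X :: "'i \<Rightarrow> 'w \<Rightarrow> 's::topological_space"
  assumes "i \<in> I"
  shows "X i \<in> borel_measurable (generated_sigma M X I)"
proof (rule measurableI)
  fix A :: "'s set" assume "A \<in> sets borel"
  then have "X i -` A \<inter> space M \<in> {X i -` A \<inter> space M | i A. i \<in> I \<and> A \<in> sets borel}"
    using assms by blast
  then show "X i -` A \<inter> space (generated_sigma M X I) \<in> sets (generated_sigma M X I)"
    unfolding space_generated_sigma sets_generated_sigma by (rule sigma_sets.Basic)
qed simp

text \<open>Turns the tail of the reversed chain into the past of the forward chain, to which the
  Markov property refers. Every \<open>j \<le> - int n\<close> is nonpositive, hence of the form
  \<open>- int i\<close> with \<open>i = nat (- j)\<close>.\<close>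

lemma generated_sigma_time_reversal:
  fixes X :: "int \<Rightarrow> 'w \<Rightarrow> 's::topological_space"
  shows "generated_sigma M (\<lambda>n. X (- int n)) {n..} = generated_sigma M X {..- int n}"
proof -
  have "{X (- int i) -` A \<inter> space M | i A. i \<in> {n..} \<and> A \<in> sets borel} =
      {X i -` A \<inter> space M | i A. i \<in> {..- int n} \<and> A \<in> sets borel}" (is "?L = ?R")
  proof
    show "?L \<subseteq> ?R"
    proof
      fix S assume "S \<in> ?L"
      then obtain i A where "S = X (- int i) -` A \<inter> space M" "i \<in> {n..}" "A \<in> sets borel" by blast
      then show "S \<in> ?R" by (intro CollectI exI[of _ "- int i"] exI[of _ A]) simp
    qed
    show "?R \<subseteq> ?L"
    proof
      fix S assume "S \<in> ?R"
      then obtain j A where "S = X j -` A \<inter> space M" "j \<in> {..- int n}" "A \<in> sets borel" by blast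
      then show "S \<in> ?L" by (intro CollectI exI[of _ "nat (- j)"] exI[of _ A]) auto
    qed
  qed
  then show ?thesis unfolding generated_sigma_def by simp
qed

text \<open>Isolates a single transition. \<open>K_law\<close> gives the conditional law of
  \<open>X\<close> only set by set, with an exceptional null set for each \<open>A\<close>, exactly
  as in \<open>stationary_markov_chain\<close>; the extension to functions is made here.\<close>

locale conditional_law = prob_space M
  for M :: "'w measure" +
  fixes F :: "'w measure" and X :: "'w \<Rightarrow> 's::topological_space" and K :: "'w \<Rightarrow> 's measure"
  assumes subalgebra: "subalgebra M F"
    and X_measurable [measurable]: "X \<in> borel_measurable M"
    and K_finite: "\<And>\<omega>. finite_measure (K \<omega>)"
    and K_sets: "\<And>\<omega>. sets (K \<omega>) = sets borel"
    and K_law: "\<And>A. A \<in> sets borel \<Longrightarrow>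
      AE \<omega> in M. real_cond_exp M F (\<lambda>\<omega>'. indicator A (X \<omega>')) \<omega> = measure (K \<omega>) A"
begin

sublocale sigma_finite_subalgebra M F
proof -
  interpret finite_measure_subalgebra M F
    by unfold_locales (rule subalgebra)
  show "sigma_finite_subalgebra M F" by unfold_locales
qed

text \<open>Only the inequality is proved because it needs no measurability of \<open>\<omega> \<mapsto> \<integral>\<^sup>+ y. g y \<partial>K \<omega>\<close>.\<close>

lemma nn_cond_exp_ge:
  assumes "g \<in> borel_measurable borel"
  shows "AE \<omega> in M. (\<integral>\<^sup>+ y. g y \<partial>K \<omega>) \<le> nn_cond_exp M F (\<lambda>\<omega>. g (X \<omega>)) \<omega>"
  using assms
proof (induction rule: borel_measurable_induct)
  case (cong f g)
  then have "f = g" by auto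
  then show ?case using cong by simp
next
  case (set A)
  \<comment> \<open>\<open>K_law\<close> speaks of \<open>real_cond_exp\<close>, a difference of two
    \<open>enn2real\<close> terms. Dropping the subtracted one and returning to
    \<open>ennreal\<close> can only lose in the permitted direction.\<close>
  have bound: "ennreal (real_cond_exp M F (\<lambda>\<omega>'. indicator A (X \<omega>')) \<omega>)
      \<le> nn_cond_exp M F (\<lambda>\<omega>. indicator A (X \<omega>)) \<omega>" for \<omega>
  proof -
    have "(\<lambda>\<omega>'. ennreal (indicator A (X \<omega>'))) = (\<lambda>\<omega>'. indicator A (X \<omega>'))"
      by (auto simp: indicator_def)
    then have "real_cond_exp M F (\<lambda>\<omega>'. indicator A (X \<omega>')) \<omega>
        \<le> enn2real (nn_cond_exp M F (\<lambda>\<omega>. indicator A (X \<omega>)) \<omega>)"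
      by (simp add: real_cond_exp_def)
    then have "ennreal (real_cond_exp M F (\<lambda>\<omega>'. indicator A (X \<omega>')) \<omega>)
        \<le> ennreal (enn2real (nn_cond_exp M F (\<lambda>\<omega>. indicator A (X \<omega>)) \<omega>))"
      by (rule ennreal_leI)
    also have "\<dots> \<le> nn_cond_exp M F (\<lambda>\<omega>. indicator A (X \<omega>)) \<omega>"
      by (simp add: ennreal_enn2real_if)
    finally show ?thesis .
  qed
  have K: "(\<integral>\<^sup>+ y. indicator A y \<partial>K \<omega>) = ennreal (measure (K \<omega>) A)" for \<omega>
    using set K_sets by (simp add: finite_measure.emeasure_eq_measure[OF K_finite])
  from K_law[OF set] show ?case
  proof eventually_elim
    case (elim \<omega>)
    then show ?case unfolding K using bound[of \<omega>] by simp
  qed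
next
  case (mult u c)
  have [measurable]: "u \<in> borel_measurable borel" by fact
  have "AE \<omega> in M. c * nn_cond_exp M F (\<lambda>\<omega>. u (X \<omega>)) \<omega> = nn_cond_exp M F (\<lambda>\<omega>. c * u (X \<omega>)) \<omega>"
    by (rule nn_cond_exp_prod) auto
  moreover have "AE \<omega> in M. (\<integral>\<^sup>+ y. c * u y \<partial>K \<omega>) = c * (\<integral>\<^sup>+ y. u y \<partial>K \<omega>)"
    by (intro AE_I2 nn_integral_cmult) (simp add: measurable_cong_sets[OF K_sets refl])
  ultimately show ?case
    using mult.IH
  proof eventually_elim
    case (elim \<omega>)
    then show ?case using mult_left_mono[OF elim(3), of c] by simp
  qed
next
  case (add u v)
  have [measurable]: "u \<in> borel_measurable borel" "v \<in> borel_measurable borel" by fact+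
  have "AE \<omega> in M. nn_cond_exp M F (\<lambda>\<omega>. v (X \<omega>)) \<omega> + nn_cond_exp M F (\<lambda>\<omega>. u (X \<omega>)) \<omega>
      = nn_cond_exp M F (\<lambda>\<omega>. v (X \<omega>) + u (X \<omega>)) \<omega>"
    by (rule nn_cond_exp_sum) auto
  moreover have "AE \<omega> in M. (\<integral>\<^sup>+ y. v y + u y \<partial>K \<omega>) = (\<integral>\<^sup>+ y. v y \<partial>K \<omega>) + (\<integral>\<^sup>+ y. u y \<partial>K \<omega>)"
    by (intro AE_I2 nn_integral_add) (simp_all add: measurable_cong_sets[OF K_sets refl])
  ultimately show ?case
    using add.IH
  proof eventually_elim
    case (elim \<omega>)
    then show ?case using add_mono[OF elim(4,3)] by simp
  qed
next
  case (seq U)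
  have [measurable]: "U i \<in> borel_measurable borel" for i by fact
  have mono: "AE \<omega> in M. nn_cond_exp M F (\<lambda>\<omega>. U i (X \<omega>)) \<omega> \<le> nn_cond_exp M F (\<lambda>\<omega>. (SUP i. U i) (X \<omega>)) \<omega>" for i
  proof (rule nn_cond_exp_mono)
    show "AE \<omega> in M. U i (X \<omega>) \<le> (SUP i. U i) (X \<omega>)"
      by (auto simp: SUP_apply intro!: SUP_upper AE_I2)
    show "(\<lambda>\<omega>. (SUP i. U i) (X \<omega>)) \<in> borel_measurable M"
      unfolding SUP_apply[of U UNIV] by (rule borel_measurable_SUP) auto
  qed simp
  have sup: "(\<integral>\<^sup>+ y. (SUP i. U i) y \<partial>K \<omega>) = (SUP i. \<integral>\<^sup>+ y. U i y \<partial>K \<omega>)" for \<omega>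
    unfolding SUP_apply
    by (rule nn_integral_monotone_convergence_SUP[OF \<open>incseq U\<close>]) (simp add: measurable_cong_sets[OF K_sets refl])
  \<comment> \<open>Only countably many exceptional sets arise, so the bounds hold for all
    \<open>i\<close> at once and pass to the supremum.\<close>
  have "AE \<omega> in M. \<forall>i. nn_cond_exp M F (\<lambda>\<omega>. U i (X \<omega>)) \<omega> \<le> nn_cond_exp M F (\<lambda>\<omega>. (SUP i. U i) (X \<omega>)) \<omega>"
    using mono by (simp add: AE_all_countable)
  moreover have "AE \<omega> in M. \<forall>i. (\<integral>\<^sup>+ y. U i y \<partial>K \<omega>) \<le> nn_cond_exp M F (\<lambda>\<omega>. U i (X \<omega>)) \<omega>"
    using seq.IH by (simp add: AE_all_countable)
  ultimately show ?case
  proof eventually_elim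
    case (elim \<omega>)
    show ?case unfolding sup
    proof (rule SUP_least)
      fix i
      show "(\<integral>\<^sup>+ y. U i y \<partial>K \<omega>) \<le> nn_cond_exp M F (\<lambda>\<omega>. (SUP i. U i) (X \<omega>)) \<omega>"
        using elim[THEN spec, of i] by (auto intro: order_trans)
    qed
  qed
qed

text \<open>Integrability makes the extended conditional expectation finite almost everywhere, and
  the negative part of \<open>f\<close> contributes 0, so \<open>real_cond_exp\<close> agrees with
  \<open>nn_cond_exp\<close> there.\<close>

lemma real_cond_exp_ge:
  fixes f :: "'s \<Rightarrow> real"
  assumes f [measurable]: "f \<in> borel_measurable borel" and nonneg: "\<And>y. 0 \<le> f y"
    and int: "integrable M (\<lambda>\<omega>. f (X \<omega>))"
  shows "AE \<omega> in M. (\<integral>\<^sup>+ y. ennreal (f y) \<partial>K \<omega>) \<le> ennreal (real_cond_exp M F (\<lambda>\<omega>. f (X \<omega>)) \<omega>)"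
proof -
  let ?E = "nn_cond_exp M F (\<lambda>\<omega>. ennreal (f (X \<omega>)))"
  have "(\<integral>\<^sup>+ \<omega>. ?E \<omega> \<partial>M) = (\<integral>\<^sup>+ \<omega>. ennreal (f (X \<omega>)) \<partial>M)"
    using nn_cond_exp_intg[of "\<lambda>_. 1" "\<lambda>\<omega>. ennreal (f (X \<omega>))"] by simp
  also have "\<dots> < \<infinity>"
    using int nonneg by (simp add: integrable_iff_bounded)
  finally have "AE \<omega> in M. ?E \<omega> \<noteq> \<infinity>"
    by (intro nn_integral_PInf_AE) auto
  moreover have "AE \<omega> in M. 0 = nn_cond_exp M F (\<lambda>\<omega>. 0) \<omega>"
    by (rule nn_cond_exp_F_meas) simp
  moreover have "(\<lambda>\<omega>. ennreal (- f (X \<omega>))) = (\<lambda>\<omega>. 0)"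
    using nonneg by (auto simp: ennreal_neg)
  moreover have "AE \<omega> in M. (\<integral>\<^sup>+ y. ennreal (f y) \<partial>K \<omega>) \<le> ?E \<omega>"
    by (rule nn_cond_exp_ge) simp
  ultimately show ?thesis
    unfolding real_cond_exp_def
    by (auto elim!: eventually_elim2 simp: less_top)
qed

text \<open>The law of \<open>X\<close> is an average of the measures \<open>K \<omega>\<close>, all
  of which lie below \<open>D\<close> times \<open>\<gamma>\<close>. Thus the law itself lies below
  that measure, and so do integrals of nonnegative functions.\<close>

lemma nn_integral_le_dominating:
  assumes \<gamma>: "sets \<gamma> = sets borel" and "finite_measure \<gamma>" and "0 \<le> D"
    and dom: "\<And>\<omega> A. A \<in> sets borel \<Longrightarrow> measure (K \<omega>) A \<le> D * measure \<gamma> A"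
    and g [measurable]: "g \<in> borel_measurable borel"
  shows "(\<integral>\<^sup>+ \<omega>. g (X \<omega>) \<partial>M) \<le> ennreal D * (\<integral>\<^sup>+ y. g y \<partial>\<gamma>)"
proof -
  interpret \<gamma>: finite_measure \<gamma> by fact
  have "emeasure (distr M borel X) A \<le> emeasure (scale_measure (ennreal D) \<gamma>) A" if A: "A \<in> sets borel" for A
  proof -
    have int: "integrable M (\<lambda>\<omega>. indicator A (X \<omega>) :: real)"
      using A by (intro integrable_const_bound[of _ 1]) auto
    have "measure (distr M borel X) A = (\<integral>\<omega>. indicator A (X \<omega>) \<partial>M)"
      using A by (simp add: measure_distr indicator_vimage[symmetric] flip: vimage_def)
    also have "\<dots> = (\<integral>\<omega>. real_cond_exp M F (\<lambda>\<omega>. indicator A (X \<omega>)) \<omega> \<partial>M)"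
      by (rule real_cond_exp_int(2)[OF int, symmetric])
    also have "\<dots> \<le> (\<integral>\<omega>. D * measure \<gamma> A \<partial>M)"
      using K_law[OF A] dom[OF A]
      by (intro integral_mono_AE real_cond_exp_int(1)[OF int]) (auto elim!: eventually_mono)
    finally have "measure (distr M borel X) A \<le> D * measure \<gamma> A"
      by (simp add: prob_space)
    moreover have "finite_measure (distr M borel X)"
      by (intro finite_measure_distr) simp
    ultimately show ?thesis
      using \<open>0 \<le> D\<close>
      by (simp add: finite_measure.emeasure_eq_measure \<gamma>.emeasure_eq_measure flip: ennreal_mult)
  qed
  then have "distr M borel X \<le> scale_measure (ennreal D) \<gamma>"
    using \<gamma> by (subst le_measure) auto
  then have "(\<integral>\<^sup>+ y. g y \<partial>distr M borel X) \<le> (\<integral>\<^sup>+ y. g y \<partial>scale_measure (ennreal D) \<gamma>)"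
    using \<gamma> by (intro nn_integral_mono_measure) auto
  moreover have "g \<in> borel_measurable \<gamma>"
    using g unfolding measurable_cong_sets[OF \<gamma> refl, of borel] .
  ultimately show ?thesis
    by (simp add: nn_integral_distr nn_integral_scale_measure)
qed

end

section \<open>The stationary chain of the optimal kernel\<close>

lemma stationary_markov_chain_conditional_law:
  fixes X :: "int \<Rightarrow> 'w \<Rightarrow> 's::topological_space"
  assumes "stationary_markov_chain M X P"
    and "\<And>x. finite_measure (P x)" and "\<And>x. sets (P x) = sets borel"
  shows "conditional_law M (generated_sigma M X {..n}) (X (n + 1)) (\<lambda>\<omega>. P (X n \<omega>))"
proof -
  have X: "X m \<in> borel_measurable M" for m
    using assms(1) by (simp add: stationary_markov_chain_def)
  show ?thesis
  proof (intro conditional_law.intro conditional_law_axioms.intro)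
    show "prob_space M"
      using assms(1) by (simp add: stationary_markov_chain_def)
    show "subalgebra M (generated_sigma M X {..n})"
      using X by (rule subalgebra_generated_sigma)
    fix A :: "'s set" assume "A \<in> sets borel"
    then show "AE \<omega> in M. real_cond_exp M (generated_sigma M X {..n})
        (\<lambda>\<omega>'. indicator A (X (n + 1) \<omega>')) \<omega> = measure (P (X n \<omega>)) A"
      using assms(1) by (simp add: stationary_markov_chain_def)
  qed (fact X assms(2,3))+
qed

context multiplicative_dp_solution
begin

lemma ratio_density_nonneg: "0 \<le> ratio_density x u y"
  using V_pos[of x] V_pos[of y] \<phi>_pos[of y x u] \<Lambda>_pos by (simp add: ratio_density_def)

lemma opt_kernel_eq:
  "opt_kernel (ctrl_kernel \<gamma> \<phi>) k \<Lambda> V v x = density \<gamma> (\<lambda>y. ennreal (ratio_density x (v x) y))"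
proof -
  have [measurable]: "V \<in> borel_measurable borel"
    by (rule borel_measurable_if_integrable[OF V_integrable])
  have "ennreal (\<phi> y x (v x)) * ennreal (inverse (\<Lambda> * V x) * exp (k x (v x)) * V y)
      = ennreal (ratio_density x (v x) y)" for y
    using \<phi>_pos[of y x "v x"] V_pos[of y] V_pos[of x] \<Lambda>_pos
    by (simp add: ratio_density_def field_simps flip: ennreal_mult)
  then show ?thesis
    unfolding opt_kernel_def ctrl_kernel_def
    by (subst density_density_eq) simp_all
qed

lemma sets_opt_kernel: "sets (opt_kernel (ctrl_kernel \<gamma> \<phi>) k \<Lambda> V v x) = sets borel"
  unfolding opt_kernel_eq using \<gamma>_sets by simp

text \<open>Identifies the transition average of a ratio along the chain with the weighted integral
  bounded in \<open>value_iter_ratio_le\<close>.\<close>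

lemma nn_integral_opt_kernel:
  assumes "integrable \<gamma> f" and "\<And>y. 0 \<le> f y"
  shows "(\<integral>\<^sup>+ y. ennreal (f y / V y) \<partial>opt_kernel (ctrl_kernel \<gamma> \<phi>) k \<Lambda> V v x) =
    ennreal (\<integral>y. ratio_density x (v x) y * (f y / V y) \<partial>\<gamma>)"
proof -
  have [measurable]: "f \<in> borel_measurable \<gamma>" "V \<in> borel_measurable \<gamma>"
    "ratio_density x (v x) \<in> borel_measurable \<gamma>"
    using assms(1) V_integrable ratio_density_mass(1) by auto
  have "(\<integral>\<^sup>+ y. ennreal (f y / V y) \<partial>opt_kernel (ctrl_kernel \<gamma> \<phi>) k \<Lambda> V v x) =
      (\<integral>\<^sup>+ y. ennreal (ratio_density x (v x) y) * ennreal (f y / V y) \<partial>\<gamma>)"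
    unfolding opt_kernel_eq by (rule nn_integral_density) auto
  also have "\<dots> = (\<integral>\<^sup>+ y. ennreal (ratio_density x (v x) y * (f y / V y)) \<partial>\<gamma>)"
    by (intro nn_integral_cong ennreal_mult'[symmetric] ratio_density_nonneg)
  also have "\<dots> = ennreal (\<integral>y. ratio_density x (v x) y * (f y / V y) \<partial>\<gamma>)"
    using assms(2) less_imp_le[OF V_pos] ratio_density_nonneg
    by (intro nn_integral_eq_integral ratio_density_integral(1)[OF assms(1)] AE_I2
        mult_nonneg_nonneg divide_nonneg_nonneg)
  finally show ?thesis .
qed

lemma finite_measure_opt_kernel: "finite_measure (opt_kernel (ctrl_kernel \<gamma> \<phi>) k \<Lambda> V v x)"
proof
  \<comment> \<open>Writing 1 as \<open>V y / V y\<close> reduces the total mass to the preceding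
    formula with \<open>f = V\<close>.\<close>
  have "emeasure (opt_kernel (ctrl_kernel \<gamma> \<phi>) k \<Lambda> V v x) UNIV =
      (\<integral>\<^sup>+ y. ennreal (V y / V y) \<partial>opt_kernel (ctrl_kernel \<gamma> \<phi>) k \<Lambda> V v x)"
    using less_imp_neq[OF V_pos] sets_eq_imp_space_eq[OF sets_opt_kernel]
    by (simp add: neq_commute[of 0])
  also have "\<dots> < \<infinity>"
    using nn_integral_opt_kernel[OF V_integrable less_imp_le[OF V_pos], of v x] by simp
  finally show "emeasure (opt_kernel (ctrl_kernel \<gamma> \<phi>) k \<Lambda> V v x)
      (space (opt_kernel (ctrl_kernel \<gamma> \<phi>) k \<Lambda> V v x)) \<noteq> \<infinity>"
    using sets_eq_imp_space_eq[OF sets_opt_kernel] by simp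
qed

lemma measure_opt_kernel_le:
  assumes D: "\<And>x u y. ratio_density x u y \<le> D" and "0 \<le> D" and A: "A \<in> sets borel"
  shows "measure (opt_kernel (ctrl_kernel \<gamma> \<phi>) k \<Lambda> V v x) A \<le> D * measure \<gamma> A"
proof -
  have A': "A \<in> sets \<gamma>" using A \<gamma>_sets by simp
  have [measurable]: "ratio_density x (v x) \<in> borel_measurable \<gamma>"
    using ratio_density_mass(1) by auto
  have "emeasure (opt_kernel (ctrl_kernel \<gamma> \<phi>) k \<Lambda> V v x) A =
      (\<integral>\<^sup>+ y. ennreal (ratio_density x (v x) y) * indicator A y \<partial>\<gamma>)"
    unfolding opt_kernel_eq using A' by (intro emeasure_density) auto
  also have "\<dots> \<le> (\<integral>\<^sup>+ y. ennreal D * indicator A y \<partial>\<gamma>)"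
    by (intro nn_integral_mono mult_right_mono ennreal_leI D) simp
  also have "\<dots> = ennreal (D * measure \<gamma> A)"
    using A' \<open>0 \<le> D\<close> by (simp add: emeasure_eq_measure nn_integral_cmult_indicator ennreal_mult)
  finally have "ennreal (measure (opt_kernel (ctrl_kernel \<gamma> \<phi>) k \<Lambda> V v x) A) \<le> ennreal (D * measure \<gamma> A)"
    by (simp add: finite_measure.emeasure_eq_measure[OF finite_measure_opt_kernel])
  then show ?thesis
    using \<open>0 \<le> D\<close> by (simp add: ennreal_le_iff)
qed

context
  fixes v :: "'s \<Rightarrow> 'u" and M :: "'w measure" and X :: "int \<Rightarrow> 'w \<Rightarrow> 's"
  assumes chain: "stationary_markov_chain M X (opt_kernel (ctrl_kernel \<gamma> \<phi>) k \<Lambda> V v)"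
begin

lemma chain_conditional_law:
  "conditional_law M (generated_sigma M X {..n}) (X (n + 1))
     (\<lambda>\<omega>. opt_kernel (ctrl_kernel \<gamma> \<phi>) k \<Lambda> V v (X n \<omega>))"
  by (rule stationary_markov_chain_conditional_law[OF chain finite_measure_opt_kernel sets_opt_kernel])

lemma chain_measurable: "X n \<in> borel_measurable M"
  using chain by (simp add: stationary_markov_chain_def)

text \<open>Time is two-sided, so every \<open>X n\<close> arises by a transition from
  \<open>X (n - 1)\<close>. Its law is therefore dominated by a multiple of \<open>\<gamma>\<close>,
  which transfers integrability to the chain.\<close>

lemma chain_integrable:
  fixes g :: "'s \<Rightarrow> real"
  assumes "integrable \<gamma> g"
  shows "integrable M (\<lambda>\<omega>. g (X n \<omega>))"
proof -
  interpret conditional_law M "generated_sigma M X {..n - 1}" "X n"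
    "\<lambda>\<omega>. opt_kernel (ctrl_kernel \<gamma> \<phi>) k \<Lambda> V v (X (n - 1) \<omega>)"
    using chain_conditional_law[of "n - 1"] by simp
  obtain D where D: "\<And>x u y. ratio_density x u y \<le> D"
    using ratio_density_bounds by metis
  then have "0 \<le> D" using ratio_density_nonneg order_trans by blast
  have g: "g \<in> borel_measurable borel"
    by (rule borel_measurable_if_integrable[OF assms])
  have "(\<integral>\<^sup>+ \<omega>. ennreal (norm (g (X n \<omega>))) \<partial>M) \<le> ennreal D * (\<integral>\<^sup>+ y. ennreal (norm (g y)) \<partial>\<gamma>)"
    using g by (intro nn_integral_le_dominating[OF \<gamma>_sets finite_\<gamma> \<open>0 \<le> D\<close>]
        measure_opt_kernel_le[OF D \<open>0 \<le> D\<close>]) auto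
  also have "\<dots> < \<infinity>"
    using integrableD(2)[OF integrable_norm[OF assms]]
    by (simp only: infinity_ennreal_def less_top ennreal_mult_less_top ennreal_less_top simp_thms)
  finally show ?thesis
    using measurable_compose[OF chain_measurable g] by (simp add: integrable_iff_bounded)
qed

text \<open>The next ratio is at most the average of the current one under the optimal kernel, by
  \<open>value_iter_ratio_le\<close> at the control \<open>v (X m \<omega>)\<close>. That average is
  at most the conditional expectation, by \<open>real_cond_exp_ge\<close>.\<close>

lemma chain_cond_exp_ge:
  assumes J0: "integrable \<gamma> J0" "\<And>x. 0 < J0 x"
  shows "AE \<omega> in M. J J0 (Suc n) (X m \<omega>) / V (X m \<omega>) \<le>
    real_cond_exp M (generated_sigma M X {..m}) (\<lambda>\<omega>. J J0 n (X (m + 1) \<omega>) / V (X (m + 1) \<omega>)) \<omega>"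
proof -
  note J = value_iter_props[OF J0]
  interpret conditional_law M "generated_sigma M X {..m}" "X (m + 1)"
    "\<lambda>\<omega>. opt_kernel (ctrl_kernel \<gamma> \<phi>) k \<Lambda> V v (X m \<omega>)"
    by (rule chain_conditional_law)
  have ratio_int: "integrable \<gamma> (\<lambda>y. J J0 n y / V y)"
    by (rule divide_V_integrable[OF J(1)])
  have "AE \<omega> in M. (\<integral>\<^sup>+ y. ennreal (J J0 n y / V y) \<partial>opt_kernel (ctrl_kernel \<gamma> \<phi>) k \<Lambda> V v (X m \<omega>)) \<le>
      ennreal (real_cond_exp M (generated_sigma M X {..m})
        (\<lambda>\<omega>. J J0 n (X (m + 1) \<omega>) / V (X (m + 1) \<omega>)) \<omega>)"
    using less_imp_le[OF divide_pos_pos[OF J(2) V_pos]]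
    by (rule real_cond_exp_ge[OF borel_measurable_if_integrable[OF ratio_int] _ chain_integrable[OF ratio_int]])
  then show ?thesis
  proof eventually_elim
    case (elim \<omega>)
    have "ennreal (J J0 (Suc n) (X m \<omega>) / V (X m \<omega>))
        \<le> ennreal (\<integral>y. ratio_density (X m \<omega>) (v (X m \<omega>)) y * (J J0 n y / V y) \<partial>\<gamma>)"
      by (intro ennreal_leI value_iter_ratio_le[OF J0])
    also have "\<dots> = (\<integral>\<^sup>+ y. ennreal (J J0 n y / V y) \<partial>opt_kernel (ctrl_kernel \<gamma> \<phi>) k \<Lambda> V v (X m \<omega>))"
      by (rule nn_integral_opt_kernel[OF J(1) less_imp_le[OF J(2)], symmetric])
    also note elim
    \<comment> \<open>Positivity of the left side rules out that the comparison holds merely because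
      \<open>ennreal\<close> truncates negative numbers to 0.\<close>
    finally show ?case
      using divide_pos_pos[OF J(2) V_pos, of "Suc n" "X m \<omega>" "X m \<omega>"] by (subst (asm) ennreal_le_iff2) linarith
  qed
qed

lemma value_iter_reverse_submartingale:
  assumes J0: "integrable \<gamma> J0" "\<And>x. 0 < J0 x"
  shows "reverse_submartingale M (\<lambda>n. generated_sigma M (\<lambda>n. X (- int n)) {n..})
    (\<lambda>n \<omega>. J J0 n (X (- int n) \<omega>) / V (X (- int n) \<omega>))"
  unfolding reverse_submartingale_def
proof (intro conjI allI)
  fix n
  note J = value_iter_props[OF J0]
  have ratio_int: "integrable \<gamma> (\<lambda>y. J J0 n y / V y)"
    by (rule divide_V_integrable[OF J(1)])
  show "subalgebra M (generated_sigma M (\<lambda>n. X (- int n)) {n..})"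
    by (rule subalgebra_generated_sigma) (rule chain_measurable)
  show "subalgebra (generated_sigma M (\<lambda>n. X (- int n)) {n..})
      (generated_sigma M (\<lambda>n. X (- int n)) {Suc n..})"
    by (rule subalgebra_generated_sigma_mono) auto
  have "(\<lambda>\<omega>. X (- int n) \<omega>) \<in> borel_measurable (generated_sigma M (\<lambda>n. X (- int n)) {n..})"
    using measurable_generated_sigma[of n "{n..}" "\<lambda>n. X (- int n)" M] by simp
  from measurable_compose[OF this borel_measurable_if_integrable[OF ratio_int]]
  show "(\<lambda>\<omega>. J J0 n (X (- int n) \<omega>) / V (X (- int n) \<omega>))
      \<in> borel_measurable (generated_sigma M (\<lambda>n. X (- int n)) {n..})" .
  show "integrable M (\<lambda>\<omega>. J J0 n (X (- int n) \<omega>) / V (X (- int n) \<omega>))"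
    by (rule chain_integrable[OF ratio_int])
  \<comment> \<open>One step backward for the reversed chain is the forward transition from time
    \<open>- int (Suc n)\<close> to time \<open>- int n\<close>.\<close>
  have "- int (Suc n) + 1 = - int n" by simp
  then show "AE \<omega> in M. J J0 (Suc n) (X (- int (Suc n)) \<omega>) / V (X (- int (Suc n)) \<omega>)
      \<le> real_cond_exp M (generated_sigma M (\<lambda>n. X (- int n)) {Suc n..})
        (\<lambda>\<omega>. J J0 n (X (- int n) \<omega>) / V (X (- int n) \<omega>)) \<omega>"
    unfolding generated_sigma_time_reversal
    using chain_cond_exp_ge[OF J0, of n "- int (Suc n)"] by (simp only:)
qed

text \<open>The witness for \<open>\<zeta>\<close> is the constant \<open>c\<close>. Uniform
  convergence of the ratios gives convergence along every path, and on a probability space the bound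
  \<open>e n\<close> also controls the mean deviation, which yields convergence in
  \<open>L1\<close>.\<close>

lemma value_iter_chain_limit:
  assumes J0: "integrable \<gamma> J0" "\<And>x. 0 < J0 x"
  shows "\<exists>\<zeta> \<in> borel_measurable M. integrable M \<zeta> \<and>
    (AE \<omega> in M. (\<lambda>n. J J0 n (X (- int n) \<omega>) / V (X (- int n) \<omega>)) \<longlonglongrightarrow> \<zeta> \<omega>) \<and>
    (\<lambda>n. \<integral>\<omega>. \<bar>J J0 n (X (- int n) \<omega>) / V (X (- int n) \<omega>) - \<zeta> \<omega>\<bar> \<partial>M) \<longlonglongrightarrow> 0 \<and>
    (AE \<omega> in M. AE x in \<gamma>. (\<lambda>n. J J0 n x) \<longlonglongrightarrow> \<zeta> \<omega> * V x)"
proof -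
  interpret M: prob_space M
    using chain by (simp add: stationary_markov_chain_def)
  obtain c e where c: "0 < c" "e \<longlonglongrightarrow> 0" "\<And>n x. \<bar>J J0 (Suc n) x / V x - c\<bar> \<le> e n"
    using value_iter_ratio_limit[OF J0] by metis
  \<comment> \<open>The evaluation points \<open>z n\<close> may vary arbitrarily with
    \<open>n\<close>, because the bound is uniform in the state.\<close>
  have pointwise: "(\<lambda>n. J J0 n (z n) / V (z n)) \<longlonglongrightarrow> c" for z
  proof -
    have "(\<lambda>n. J J0 (Suc n) (z (Suc n)) / V (z (Suc n)) - c) \<longlonglongrightarrow> 0"
      by (rule Lim_null_comparison[OF _ c(2)]) (use c(3) in auto)
    then show ?thesis
      unfolding LIM_zero_iff by (rule LIMSEQ_imp_Suc)
  qed
  let ?d = "\<lambda>n. \<integral>\<omega>. \<bar>J J0 n (X (- int n) \<omega>) / V (X (- int n) \<omega>) - c\<bar> \<partial>M"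
  have "0 \<le> ?d (Suc n) \<and> ?d (Suc n) \<le> e n" for n
  proof
    have "integrable M (\<lambda>\<omega>. J J0 (Suc n) (X (- int (Suc n)) \<omega>) / V (X (- int (Suc n)) \<omega>))"
      by (rule chain_integrable[OF divide_V_integrable[OF value_iter_props(1)[OF J0]]])
    then have "integrable M (\<lambda>\<omega>. \<bar>J J0 (Suc n) (X (- int (Suc n)) \<omega>) / V (X (- int (Suc n)) \<omega>) - c\<bar>)"
      by (intro integrable_abs Bochner_Integration.integrable_diff) simp_all
    then show "?d (Suc n) \<le> e n"
      by (rule M.integral_le_const) (intro AE_I2 c(3))
  qed (rule Bochner_Integration.integral_nonneg, rule abs_ge_zero)
  then have "(\<lambda>n. ?d (Suc n)) \<longlonglongrightarrow> 0"
    by (intro tendsto_sandwich[OF _ _ tendsto_const c(2)] always_eventually allI) blast+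
  then have "?d \<longlonglongrightarrow> 0" by (rule LIMSEQ_imp_Suc)
  with value_iter_limit[OF c] pointwise show ?thesis
    by (intro bexI[of _ "\<lambda>_. c"] conjI AE_I2) simp_all
qed

end

end

theorem mainTheorem1:
  fixes \<gamma> :: "'s::polish_space measure"
    and \<phi> :: "'s \<Rightarrow> 's \<Rightarrow> 'u::metric_space \<Rightarrow> real"
    and p :: "'s \<Rightarrow> 'u \<Rightarrow> 's measure"
    and k :: "'s \<Rightarrow> 'u \<Rightarrow> real"
    and \<Lambda> :: real and V :: "'s \<Rightarrow> real" and x0 :: 's and J0 V0 :: "'s \<Rightarrow> real"
    and J Vn :: "nat \<Rightarrow> 's \<Rightarrow> real"
  defines "p \<equiv> ctrl_kernel \<gamma> \<phi>"
    and "J \<equiv> value_iter p k \<Lambda> J0"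
    and "Vn \<equiv> rel_value_iter p k x0 V0"
  assumes S_compact: "compact (UNIV :: 's set)"
    and U_compact: "compact (UNIV :: 'u set)"
    and \<gamma>_sets: "sets \<gamma> = sets borel"
    and \<gamma>_support: "full_support \<gamma>"
    and \<phi>_pos: "\<And>y x u. 0 < \<phi> y x u"
    and \<phi>_cont: "continuous_on UNIV (\<lambda>(y, x, u). \<phi> y x u)"
    and p_prob: "\<And>x u. prob_space (p x u)"
    and k_cont: "continuous_on UNIV (\<lambda>(x, u). k x u)"
    and \<Lambda>_pos: "0 < \<Lambda>"
    and V_sol: "dp_solution p k \<Lambda> V"
    and V_nonzero: "\<exists>x. V x \<noteq> 0"
    and J0_pos: "\<And>x. 0 < J0 x"
    and J0_int: "integrable \<gamma> J0"
    and V0_eq: "V0 = J0"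
  shows
    "(\<forall>(v :: 's \<Rightarrow> 'u) (M :: 'w measure) (X :: int \<Rightarrow> 'w \<Rightarrow> 's) (Y :: nat \<Rightarrow> 'w \<Rightarrow> 's).
        measurable_minimizer p k V v \<longrightarrow>
        stationary_markov_chain M X (opt_kernel p k \<Lambda> V v) \<longrightarrow>
        Y = (\<lambda>n. X (- int n)) \<longrightarrow>
        reverse_submartingale M (\<lambda>n. generated_sigma M Y {n..}) (\<lambda>n \<omega>. J n (Y n \<omega>) / V (Y n \<omega>)) \<and>
        (\<exists>\<zeta> :: 'w \<Rightarrow> real.
           \<zeta> \<in> borel_measurable M \<and> integrable M \<zeta> \<and>
           (AE \<omega> in M. (\<lambda>n. J n (Y n \<omega>) / V (Y n \<omega>)) \<longlonglongrightarrow> \<zeta> \<omega>) \<and>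
           (\<lambda>n. \<integral>\<omega>. \<bar>J n (Y n \<omega>) / V (Y n \<omega>) - \<zeta> \<omega>\<bar> \<partial>M) \<longlonglongrightarrow> 0 \<and>
           (AE \<omega> in M. AE x in \<gamma>. (\<lambda>n. J n x) \<longlonglongrightarrow> \<zeta> \<omega> * V x)))
     \<and>
     (\<exists>Vbar :: 's \<Rightarrow> real.
        (AE x in \<gamma>. (\<lambda>n. Vn n x) \<longlonglongrightarrow> Vbar x) \<and>
        dp_solution p k \<Lambda> Vbar \<and> Vbar x0 = \<Lambda> \<and>
        (\<forall>W. dp_solution p k \<Lambda> W \<and> W x0 = \<Lambda> \<longrightarrow> W = Vbar))"
proof -
  interpret multiplicative_dp_solution \<gamma> \<phi> k \<Lambda> V
    by (intro multiplicative_dp_solution.intro multiplicative_dp.intro multiplicative_dp_solution_axioms.intro;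
        fact S_compact U_compact \<gamma>_sets \<gamma>_support \<phi>_pos \<phi>_cont p_prob[unfolded p_def] k_cont \<Lambda>_pos
          V_sol[unfolded p_def] V_nonzero)
  have chain: "reverse_submartingale M (\<lambda>n. generated_sigma M Y {n..}) (\<lambda>n \<omega>. J n (Y n \<omega>) / V (Y n \<omega>)) \<and>
      (\<exists>\<zeta> :: 'w \<Rightarrow> real.
         \<zeta> \<in> borel_measurable M \<and> integrable M \<zeta> \<and>
         (AE \<omega> in M. (\<lambda>n. J n (Y n \<omega>) / V (Y n \<omega>)) \<longlonglongrightarrow> \<zeta> \<omega>) \<and>
         (\<lambda>n. \<integral>\<omega>. \<bar>J n (Y n \<omega>) / V (Y n \<omega>) - \<zeta> \<omega>\<bar> \<partial>M) \<longlonglongrightarrow> 0 \<and>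
         (AE \<omega> in M. AE x in \<gamma>. (\<lambda>n. J n x) \<longlonglongrightarrow> \<zeta> \<omega> * V x))"
    if "stationary_markov_chain M X (opt_kernel p k \<Lambda> V v)" and Y: "Y = (\<lambda>n. X (- int n))"
    for v :: "'s \<Rightarrow> 'u" and M :: "'w measure" and X Y
    unfolding J_def p_def Y
    using value_iter_reverse_submartingale[OF that(1)[unfolded p_def] J0_int J0_pos]
      value_iter_chain_limit[OF that(1)[unfolded p_def] J0_int J0_pos]
    by blast
  \<comment> \<open>The multiple of \<open>V\<close> normalized to take the value
    \<open>\<Lambda>\<close> at \<open>x0\<close>.\<close>
  define Vbar where "Vbar = (\<lambda>x. \<Lambda> / V x0 * V x)"
  \<comment> \<open>Convergence holds at every state; the almost everywhere claim is read off from
    it.\<close>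
  have lim: "(\<lambda>n. Vn n x) \<longlonglongrightarrow> Vbar x" for x
    unfolding Vn_def p_def V0_eq Vbar_def by (rule rel_value_iter_limit[OF J0_int J0_pos])
  have sol: "dp_solution p k \<Lambda> Vbar"
    unfolding p_def Vbar_def using V_pos[of x0] \<Lambda>_pos
    by (intro dp_solution_scale[OF local.V_sol]) simp
  have norm: "Vbar x0 = \<Lambda>"
    using V_pos[of x0] by (simp add: Vbar_def)
  have unique: "W = Vbar" if "dp_solution p k \<Lambda> W" and "W x0 = \<Lambda>" for W
    unfolding Vbar_def by (rule dp_solution_unique[OF that(1)[unfolded p_def] that(2)])
  show ?thesis
  proof (rule conjI)
    show "\<exists>Vbar. (AE x in \<gamma>. (\<lambda>n. Vn n x) \<longlonglongrightarrow> Vbar x) \<and>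
        dp_solution p k \<Lambda> Vbar \<and> Vbar x0 = \<Lambda> \<and>
        (\<forall>W. dp_solution p k \<Lambda> W \<and> W x0 = \<Lambda> \<longrightarrow> W = Vbar)"
    proof (intro exI[of _ Vbar] conjI allI impI)
      show "AE x in \<gamma>. (\<lambda>n. Vn n x) \<longlonglongrightarrow> Vbar x"
        using lim by (rule AE_I2)
    qed (use sol norm unique in blast)+
  qed (intro allI impI, rule chain)
qed

end
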